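(* For every $\varepsilon>0$ and integer $k \ge 2$ there is an $\eta>0$ such that for all sufficiently large $n$ the following holds: if $\mathcal{F}$ is a family of subsets of $[n]$ of size $m := |\mathcal{F}| \ge (1-\eta)k2^{n/k}$ with $\operatorname{dp}(\mathcal{F}) \ge (1-\frac{1}{k}-\eta)\frac{m^2}{2}$, then $k$ divides $n$ and there is a balanced series of $k$ cubes over $[n]$ that contains all but at most $\varepsilon m$ members of $\mathcal{F}$.
   Context: For a family $\mathcal{G}$ of subsets of $[n]=\{1,\ldots,n\}$, $\operatorname{dp}(\mathcal{G})$ is the number of unordered pairs $\{A,B\}$ with $A,B\in\mathcal{G}$ and $A\cap B=\emptyset$ (where $A=B=\emptyset$ is allowed and counted as one pair). A balanced series of $k$ cubes over $[n]$ is a family $\bigcup_{i=1}^k \{A : A \subseteq S_i\}$ where $S_1,\ldots,S_k$ is a partition of $[n]$ with $\lfloor n/k\rfloor \le |S_i| \le \lceil n/k\rceil$ for each $i$. *)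

theory Defs
  imports Complex_Main
begin

text \<open>Number of unordered pairs {A,B} of members of G with A and B disjoint;
  the pair with A = B = {} is counted once (as the singleton {{}}).\<close>
definition dp :: "nat set set \<Rightarrow> nat" where
  "dp G = card {{A, B} | A B. A \<in> G \<and> B \<in> G \<and> A \<inter> B = {}}"

definition balanced_series :: "nat \<Rightarrow> nat \<Rightarrow> nat set set \<Rightarrow> bool" where
  "balanced_series k n C \<longleftrightarrow>
     (\<exists>S :: nat \<Rightarrow> nat set.
        (\<Union>i<k. S i) = {1..n} \<and>
        (\<forall>i<k. \<forall>j<k. i \<noteq> j \<longrightarrow> S i \<inter> S j = {}) \<and>
        (\<forall>i<k. n div k \<le> card (S i) \<and> card (S i) \<le> (n + k - 1) div k) \<and>
        C = (\<Union>i<k. Pow (S i)))"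

end

theory Submission
  imports Defs "HOL-Analysis.Convex"
begin

text \<open>
  Consider the disjointness graph on \<open>F\<close>. It has few \<open>(k+1)\<close>-cliques: otherwise one could choose,
  coordinate by coordinate, boundedly many members whose union has more than \<open>n/(k+1)\<close> elements while a
  positive proportion of the partial cliques still extends all of them, and the \<open>k + 1\<close> unions so
  obtained would be disjoint. Since the edge density is nearly \<open>1 - 1/k\<close>, the Moon--Moser inequalities
  are then nearly tight, so the classes of members missing exactly one vertex of a typical \<open>k\<close>-clique
  form an almost partition of \<open>F\<close> into \<open>k\<close> nearly equal parts with almost all cross pairs disjoint.
  Let \<open>U i\<close> be the set of points lying in a non-negligible proportion of part \<open>i\<close>. The \<open>U i\<close> are disjoint,
  almost every member of part \<open>i\<close> avoids all other \<open>U j\<close>, and each of the remaining \<open>r\<close> points lies in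
  few members, so an entropy bound gives a product of the part sizes at most \<open>2 ^ (n - r / 2)\<close>. This product is
  nearly \<open>2 ^ n\<close>, hence \<open>r = 0\<close>, each \<open>U i\<close> has exactly \<open>n / k\<close> points, and part \<open>i\<close> nearly fills the
  cube \<open>Pow (U i)\<close>.
\<close>

section \<open>Dense sets of lists of disjoint sets\<close>

text \<open>Jensen's inequality for \<open>x ^ t\<close>: by Bernoulli every value lies above the
  tangent line at \<open>a\<close>, whose slope is nonnegative, so a surplus of the average over
  \<open>a\<close> only helps.\<close>

lemma sum_power_ge_average:
  fixes d :: "'a \<Rightarrow> real"
  assumes nonneg: "\<And>i. i \<in> I \<Longrightarrow> 0 \<le> d i" and "0 \<le> a"
    and avg: "real (card I) * a \<le> sum d I"
  shows "real (card I) * a ^ t \<le> (\<Sum>i\<in>I. d i ^ t)"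
proof (cases "a = 0")
  case True
  then show ?thesis
    by (cases t) (auto intro!: sum_nonneg mult_nonneg_nonneg zero_le_power nonneg)
next
  case False
  with \<open>0 \<le> a\<close> have "a > 0" by simp
  \<comment> \<open>The tangent slope \<open>t a^(t-1)\<close>, written as a quotient so that
    \<open>t = 0\<close> involves no truncated subtraction.\<close>
  define b where "b = real t * a ^ t / a"
  have tangent: "a ^ t + b * (d i - a) \<le> d i ^ t" if "i \<in> I" for i
  proof -
    have "1 + real t * (d i / a - 1) \<le> (1 + (d i / a - 1)) ^ t"
      using nonneg[OF that] \<open>a > 0\<close> by (intro Bernoulli_inequality) (simp add: field_simps)
    then have "a ^ t * (1 + real t * (d i / a - 1)) \<le> a ^ t * (d i / a) ^ t"
      using \<open>a > 0\<close> by (intro mult_left_mono) auto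
    also have "\<dots> = d i ^ t"
      using \<open>a > 0\<close> by (simp add: power_divide)
    finally show ?thesis
      using \<open>a > 0\<close> by (simp add: b_def field_simps)
  qed
  have "real (card I) * a ^ t
      \<le> real (card I) * a ^ t + b * (sum d I - real (card I) * a)"
    using avg \<open>a > 0\<close> by (simp add: b_def)
  also have "\<dots> = (\<Sum>i\<in>I. a ^ t + b * (d i - a))"
    by (simp add: sum.distrib sum_distrib_left[symmetric] sum_subtractf)
  also have "\<dots> \<le> (\<Sum>i\<in>I. d i ^ t)"
    by (intro sum_mono tangent)
  finally show ?thesis .
qed

text \<open>Tuples with repetition allowed: there are exactly \<open>card F ^ s\<close> of them, the
  count against which densities are measured below.\<close>

definition lists_over :: "'a set \<Rightarrow> nat \<Rightarrow> 'a list set" where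
  "lists_over F s = {xs. set xs \<subseteq> F \<and> length xs = s}"

lemma finite_lists_over [simp]: "finite F \<Longrightarrow> finite (lists_over F s)"
  unfolding lists_over_def by (rule finite_lists_length_eq)

lemma card_lists_over [simp]: "finite F \<Longrightarrow> card (lists_over F s) = card F ^ s"
  unfolding lists_over_def by (rule card_lists_length_eq)

text \<open>The common link of the entries of \<open>ys\<close>, with \<open>T\<close> viewed as the
  edge set of an ordered hypergraph.\<close>

definition common_tails :: "'a set \<Rightarrow> nat \<Rightarrow> 'a list set \<Rightarrow> 'a list \<Rightarrow> 'a list set" where
  "common_tails F s T ys = {xs \<in> lists_over F s. \<forall>y\<in>set ys. y # xs \<in> T}"

text \<open>Count pairs \<open>(ys, xs)\<close> in which every entry of \<open>ys\<close> is a valid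
  head for \<open>xs\<close>. A tail with \<open>d\<close> valid heads occurs \<open>d ^ t\<close>
  times, and these \<open>d\<close> average at least \<open>g * card F\<close>, so convexity
  applies.\<close>

lemma sum_card_common_tails:
  assumes "finite F" and T: "T \<subseteq> lists_over F (Suc s)" and "0 \<le> g"
    and dense: "g * real (card F) ^ Suc s \<le> real (card T)"
  shows "g ^ t * real (card F) ^ s * real (card F) ^ t
    \<le> (\<Sum>ys\<in>lists_over F t. real (card (common_tails F s T ys)))"
proof -
  let ?L = "lists_over F s"
  define D where "D xs = {y \<in> F. y # xs \<in> T}" for xs
  have finD: "finite (D xs)" for xs
    using \<open>finite F\<close> by (simp add: D_def)
  have "T = (\<lambda>(xs, y). y # xs) ` (SIGMA xs:?L. D xs)"
  proof (intro equalityI subsetI)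
    fix zs assume "zs \<in> T"
    with T have "set zs \<subseteq> F" "length zs = Suc s" by (auto simp: lists_over_def)
    then obtain y xs where "zs = y # xs" "xs \<in> ?L" "y \<in> F"
      by (cases zs) (auto simp: lists_over_def)
    with \<open>zs \<in> T\<close> show "zs \<in> (\<lambda>(xs, y). y # xs) ` (SIGMA xs:?L. D xs)"
      by (auto simp: D_def image_iff)
  qed (auto simp: D_def)
  then have "card T = card (SIGMA xs:?L. D xs)"
    by (simp add: card_image inj_on_def)
  also have "\<dots> = (\<Sum>xs\<in>?L. card (D xs))"
    using \<open>finite F\<close> finD by (simp add: card_SigmaI)
  finally have cardT: "real (card T) = (\<Sum>xs\<in>?L. real (card (D xs)))"
    by simp
  have "real (card ?L) * (g * real (card F)) ^ t \<le> (\<Sum>xs\<in>?L. real (card (D xs)) ^ t)"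
    using dense cardT \<open>finite F\<close> \<open>0 \<le> g\<close>
    by (intro sum_power_ge_average) (auto simp: algebra_simps)
  also have "\<dots> = (\<Sum>xs\<in>?L. real (card {ys \<in> lists_over F t. set ys \<subseteq> D xs}))"
  proof (intro sum.cong refl)
    fix xs
    have "{ys \<in> lists_over F t. set ys \<subseteq> D xs} = lists_over (D xs) t"
      by (auto simp: lists_over_def D_def)
    then show "real (card (D xs)) ^ t = real (card {ys \<in> lists_over F t. set ys \<subseteq> D xs})"
      using finD by simp
  qed
  also have "\<dots> = (\<Sum>xs\<in>?L. \<Sum>ys\<in>lists_over F t. if set ys \<subseteq> D xs then 1 else 0)"
    using \<open>finite F\<close> by (intro sum.cong refl) (simp add: sum.If_cases Int_def)
  also have "\<dots> = (\<Sum>ys\<in>lists_over F t. \<Sum>xs\<in>?L. if set ys \<subseteq> D xs then 1 else 0)"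
    by (rule sum.swap)
  also have "\<dots> = (\<Sum>ys\<in>lists_over F t. real (card (common_tails F s T ys)))"
  proof (intro sum.cong refl)
    fix ys assume "ys \<in> lists_over F t"
    then have "common_tails F s T ys = {xs \<in> ?L. set ys \<subseteq> D xs}"
      by (auto simp: common_tails_def D_def lists_over_def)
    then show "(\<Sum>xs\<in>?L. if set ys \<subseteq> D xs then 1 else 0) = real (card (common_tails F s T ys))"
      using \<open>finite F\<close> by (simp add: sum.If_cases Int_def)
  qed
  finally show ?thesis
    using \<open>finite F\<close> by (simp add: power_mult_distrib mult_ac)
qed

text \<open>Union bound: there are at most \<open>2 ^ card V\<close> candidates for the union, and
  once it is fixed each of the \<open>t\<close> entries is one of its at most \<open>2 ^ q\<close>
  subsets.\<close>

lemma card_lists_small_union: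
  fixes F :: "'a set set"
  assumes "finite V" and F: "F \<subseteq> Pow V"
  shows "card {ys \<in> lists_over F t. card (\<Union>(set ys)) \<le> q} \<le> 2 ^ card V * 2 ^ (q * t)"
proof -
  let ?P = "{U \<in> Pow V. card U \<le> q}"
  have finU: "finite U" if "U \<in> ?P" for U
    using that \<open>finite V\<close> by (auto intro: finite_subset)
  have "{ys \<in> lists_over F t. card (\<Union>(set ys)) \<le> q} \<subseteq> (\<Union>U\<in>?P. lists_over (Pow U) t)"
  proof
    fix ys assume ys: "ys \<in> {ys \<in> lists_over F t. card (\<Union>(set ys)) \<le> q}"
    then have "\<Union>(set ys) \<in> ?P" using F by (auto simp: lists_over_def)
    moreover have "ys \<in> lists_over (Pow (\<Union>(set ys))) t"
      using ys by (auto simp: lists_over_def)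
    ultimately show "ys \<in> (\<Union>U\<in>?P. lists_over (Pow U) t)" by blast
  qed
  then have "card {ys \<in> lists_over F t. card (\<Union>(set ys)) \<le> q} \<le> card (\<Union>U\<in>?P. lists_over (Pow U) t)"
  proof (rule card_mono[rotated], intro finite_UN_I)
    show "finite (lists_over (Pow U) t)" if "U \<in> ?P" for U
      using finU[OF that] by simp
  qed (simp add: \<open>finite V\<close>)
  also have "\<dots> \<le> (\<Sum>U\<in>?P. card (lists_over (Pow U) t))"
    using \<open>finite V\<close> by (intro card_UN_le) simp
  also have "\<dots> \<le> (\<Sum>U\<in>?P. 2 ^ (q * t))"
  proof (intro sum_mono)
    fix U assume "U \<in> ?P"
    then have "card (lists_over (Pow U) t) = (2 ^ card U) ^ t"
      by (subst card_lists_over) (simp_all only: finite_Pow_iff finU card_Pow)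
    also have "\<dots> = 2 ^ (card U * t)"
      by (rule power_mult[symmetric])
    also have "\<dots> \<le> 2 ^ (q * t)"
      using \<open>U \<in> ?P\<close> by (intro power_increasing) auto
    finally show "card (lists_over (Pow U) t) \<le> 2 ^ (q * t)" .
  qed
  also have "\<dots> = card ?P * 2 ^ (q * t)" by simp
  also have "\<dots> \<le> card (Pow V) * 2 ^ (q * t)"
    using \<open>finite V\<close> by (intro mult_right_mono card_mono) auto
  finally show ?thesis using \<open>finite V\<close> by (simp add: card_Pow)
qed

text \<open>The value of \<open>t\<close> makes this crude count suffice: with
  \<open>n = card V\<close>, there are at most \<open>2 ^ (n + 2 * k * n)\<close> such lists, while
  \<open>card F ^ t\<close> is at least \<open>2 ^ (2 * n + 2 * k * n)\<close>.\<close>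

lemma small_union_fraction:
  fixes F :: "'a set set"
  assumes "finite V" and F: "F \<subseteq> Pow V" and "k \<ge> 1"
    and large: "2 powr (real (card V) / real k) \<le> real (card F)"
    and t: "t = 2 * k * (k + 1)"
  shows "real (card {ys \<in> lists_over F t. (k + 1) * card (\<Union>(set ys)) \<le> card V})
    \<le> (1/2) ^ card V * real (card F) ^ t"
proof -
  let ?n = "card V"
  define q where "q = ?n div (k + 1)"
  have "{ys \<in> lists_over F t. (k + 1) * card (\<Union>(set ys)) \<le> ?n}
      = {ys \<in> lists_over F t. card (\<Union>(set ys)) \<le> q}"
    unfolding q_def by (simp add: less_eq_div_iff_mult_less_eq mult.commute)
  then have "card {ys \<in> lists_over F t. (k + 1) * card (\<Union>(set ys)) \<le> ?n} \<le> 2 ^ ?n * 2 ^ (q * t)"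
    using card_lists_small_union[OF \<open>finite V\<close> F, of t q] by (simp only:)
  then have "real (card {ys \<in> lists_over F t. (k + 1) * card (\<Union>(set ys)) \<le> ?n})
      \<le> real (2 ^ ?n * 2 ^ (q * t))"
    by (rule of_nat_mono)
  also have "\<dots> \<le> 2 ^ ?n * 2 ^ (2 * k * ?n)"
  proof -
    have "q * t = (q * (k + 1)) * (2 * k)" unfolding t by (simp only: mult_ac)
    also have "\<dots> \<le> ?n * (2 * k)"
      unfolding q_def by (intro mult_le_mono1 div_times_less_eq_dividend)
    finally have "q * t \<le> 2 * k * ?n" by (simp only: mult_ac)
    then show ?thesis by (simp add: power_increasing)
  qed
  also have "\<dots> = (1/2) ^ ?n * 2 ^ (2 * ?n + 2 * k * ?n)"
    by (simp add: power_add mult_2 power_divide)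
  also have "(2::real) ^ (2 * ?n + 2 * k * ?n) = (2 powr (real ?n / real k)) ^ t"
  proof -
    have "real ?n / real k * real t = real (2 * ?n + 2 * k * ?n)"
      using \<open>k \<ge> 1\<close> by (simp add: t field_simps)
    then have "2 powr (real (2 * ?n + 2 * k * ?n)) = (2 powr (real ?n / real k)) powr real t"
      by (simp only: powr_powr)
    then show ?thesis by (simp only: powr_realpow zero_less_numeral powr_gt_zero)
  qed
  also have "(1/2) ^ ?n * \<dots> \<le> (1/2) ^ ?n * real (card F) ^ t"
    using large by (intro mult_left_mono power_mono) auto
  finally show ?thesis .
qed

text \<open>Induction on the tuple length. Many common heads whose union \<open>Y\<close> has more
  than \<open>n / (k + 1)\<close> points leave tails that are still dense and live inside
  \<open>X - Y\<close>, so each coordinate uses up that many points of \<open>X\<close>.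
  \<open>N\<close> depends only on \<open>k\<close>, \<open>s\<close> and \<open>g\<close>;
  \<open>s = 0\<close> is split off because the strict inequality fails there for empty
  \<open>X\<close>.\<close>

lemma dense_disjoint_lists:
  fixes k s :: nat and g :: real
  assumes "k \<ge> 1" and "g > 0"
  shows "\<exists>N. \<forall>(V :: 'a set) F X T. card V \<ge> N \<longrightarrow> finite V \<longrightarrow> F \<subseteq> Pow V \<longrightarrow>
    2 powr (real (card V) / real k) \<le> real (card F) \<longrightarrow> X \<subseteq> V \<longrightarrow>
    T \<subseteq> {xs \<in> lists_over (F \<inter> Pow X) s. sorted_wrt (\<lambda>A B. A \<inter> B = {}) xs} \<longrightarrow>
    g * real (card F) ^ s \<le> real (card T) \<longrightarrow> s = 0 \<or> s * card V < (k + 1) * card X"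
  using \<open>g > 0\<close>
proof (induction s arbitrary: g)
  case 0
  then show ?case by simp
next
  case (Suc s)
  define t where "t = 2 * k * (k + 1)"
  \<comment> \<open>Half of the average proportion \<open>g ^ t\<close> of common tails; the other
    half outweighs the head lists with small union.\<close>
  define g' where "g' = g ^ t / 2"
  have "g' > 0" using Suc.prems by (simp add: g'_def)
  from Suc.IH[OF this] obtain N where N: "\<And>(V :: 'a set) F X T. card V \<ge> N \<Longrightarrow> finite V \<Longrightarrow> F \<subseteq> Pow V \<Longrightarrow>
    2 powr (real (card V) / real k) \<le> real (card F) \<Longrightarrow> X \<subseteq> V \<Longrightarrow>
    T \<subseteq> {xs \<in> lists_over (F \<inter> Pow X) s. sorted_wrt (\<lambda>A B. A \<inter> B = {}) xs} \<Longrightarrow>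
    g' * real (card F) ^ s \<le> real (card T) \<Longrightarrow> s = 0 \<or> s * card V < (k + 1) * card X"
    by blast
  obtain M where M: "(1/2) ^ M < g'"
    using real_arch_pow_inv[OF \<open>g' > 0\<close>, of "1/2"] by auto
  show ?case
  proof (intro exI[of _ "max N M"] allI impI disjI2)
    fix V :: "'a set" and F X T
    assume n: "max N M \<le> card V" and "finite V" and F: "F \<subseteq> Pow V"
      and large: "2 powr (real (card V) / real k) \<le> real (card F)" and X: "X \<subseteq> V"
      and T: "T \<subseteq> {xs \<in> lists_over (F \<inter> Pow X) (Suc s). sorted_wrt (\<lambda>A B. A \<inter> B = {}) xs}"
      and dense: "g * real (card F) ^ Suc s \<le> real (card T)"
    let ?n = "card V" and ?m = "real (card F)"
    have "finite F" using F \<open>finite V\<close> by (simp add: finite_subset)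
    have "0 < 2 powr (real ?n / real k)" by simp
    with large have "?m > 0" by linarith
    have "(1/2) ^ ?n \<le> (1/2 :: real) ^ M"
      using n by (intro power_decreasing) auto
    with M have half: "(1/2) ^ ?n < g'" by linarith
    define bad where "bad = {ys \<in> lists_over F t. (k + 1) * card (\<Union>(set ys)) \<le> ?n}"
    have bad_card: "real (card bad) \<le> (1/2) ^ ?n * ?m ^ t"
      unfolding bad_def using small_union_fraction[OF \<open>finite V\<close> F \<open>k \<ge> 1\<close> large t_def] .
    let ?c = "\<lambda>ys. real (card (common_tails F s T ys))"
    have c_le: "?c ys \<le> ?m ^ s" for ys
    proof -
      have "card (common_tails F s T ys) \<le> card (lists_over F s)"
        using \<open>finite F\<close> by (intro card_mono) (auto simp: common_tails_def)
      then have "card (common_tails F s T ys) \<le> card F ^ s"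
        using \<open>finite F\<close> by simp
      then show ?thesis by (metis of_nat_mono of_nat_power)
    qed
    \<comment> \<open>Averaging: if every head list with large union had fewer common tails, these
      lists and the few bad ones together would fall short of the total
      \<open>2 * g' * card F ^ (s + t)\<close>.\<close>
    have "\<exists>ys\<in>lists_over F t - bad. g' * ?m ^ s \<le> ?c ys"
    proof (rule ccontr)
      assume "\<not> ?thesis"
      then have small: "?c ys \<le> g' * ?m ^ s" if "ys \<in> lists_over F t - bad" for ys
        using that by force
      have "2 * g' * ?m ^ s * ?m ^ t \<le> (\<Sum>ys\<in>lists_over F t. ?c ys)"
        using sum_card_common_tails[OF \<open>finite F\<close> _ _ dense, of t] T Suc.prems
        by (fastforce simp: g'_def lists_over_def)
      also have "\<dots> = (\<Sum>ys\<in>lists_over F t - bad. ?c ys) + (\<Sum>ys\<in>bad. ?c ys)"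
        using \<open>finite F\<close> by (intro sum.subset_diff) (auto simp: bad_def)
      also have "\<dots> \<le> real (card (lists_over F t - bad)) * (g' * ?m ^ s) + real (card bad) * ?m ^ s"
        using small c_le by (intro add_mono sum_bounded_above) auto
      also have "\<dots> \<le> ?m ^ t * (g' * ?m ^ s) + ((1/2) ^ ?n * ?m ^ t) * ?m ^ s"
      proof (intro add_mono mult_right_mono bad_card)
        have "card (lists_over F t - bad) \<le> card F ^ t"
          using \<open>finite F\<close> by (metis card_lists_over card_mono Diff_subset finite_lists_over)
        then show "real (card (lists_over F t - bad)) \<le> ?m ^ t"
          by (metis of_nat_mono of_nat_power)
      qed (use \<open>g' > 0\<close> in auto)
      also have "\<dots> = (g' + (1/2) ^ ?n) * (?m ^ s * ?m ^ t)"
        by (simp add: algebra_simps)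
      also have "\<dots> < (g' + g') * (?m ^ s * ?m ^ t)"
        using half \<open>?m > 0\<close> by (intro mult_strict_right_mono) auto
      finally show False by (simp add: algebra_simps)
    qed
    then obtain ys where ys: "ys \<in> lists_over F t" "ys \<notin> bad"
      and rich: "g' * ?m ^ s \<le> ?c ys" by blast
    define Y where "Y = \<Union>(set ys)"
    have bigY: "?n < (k + 1) * card Y"
      using ys by (simp add: bad_def Y_def)
    \<comment> \<open>A head must exist for membership and pairwise disjointness to pass from
      \<open>T\<close> to the tails.\<close>
    have "t > 0" using \<open>k \<ge> 1\<close> by (simp add: t_def)
    with ys have "set ys \<noteq> {}" by (auto simp: lists_over_def)
    have "0 < g' * ?m ^ s" using \<open>g' > 0\<close> \<open>?m > 0\<close> by simp
    with rich have "common_tails F s T ys \<noteq> {}" by auto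
    then have "Y \<subseteq> X"
      using T unfolding Y_def common_tails_def lists_over_def by fastforce
    have "common_tails F s T ys
        \<subseteq> {xs \<in> lists_over (F \<inter> Pow (X - Y)) s. sorted_wrt (\<lambda>A B. A \<inter> B = {}) xs}"
    proof
      fix xs assume xs: "xs \<in> common_tails F s T ys"
      have *: "y # xs \<in> lists_over (F \<inter> Pow X) (Suc s)" "sorted_wrt (\<lambda>A B. A \<inter> B = {}) (y # xs)"
        if "y \<in> set ys" for y
      proof -
        have "y # xs \<in> T" using xs that by (simp add: common_tails_def)
        with T show "y # xs \<in> lists_over (F \<inter> Pow X) (Suc s)" "sorted_wrt (\<lambda>A B. A \<inter> B = {}) (y # xs)"
          by blast+
      qed
      obtain y where "y \<in> set ys" using \<open>set ys \<noteq> {}\<close> by (metis ex_in_conv)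
      from *[OF this] have xs': "set xs \<subseteq> F \<inter> Pow X" "length xs = s"
          "sorted_wrt (\<lambda>A B. A \<inter> B = {}) xs"
        by (auto simp: lists_over_def)
      have "z \<inter> A = {}" if "A \<in> set xs" "z \<in> set ys" for A z
        using *(2)[OF \<open>z \<in> set ys\<close>] that by simp
      then have "A \<inter> Y = {}" if "A \<in> set xs" for A
        using that by (auto simp: Y_def)
      with xs' show "xs \<in> {xs \<in> lists_over (F \<inter> Pow (X - Y)) s. sorted_wrt (\<lambda>A B. A \<inter> B = {}) xs}"
        unfolding lists_over_def by blast
    qed
    \<comment> \<open>The weak inequality also covers \<open>s = 0\<close>; strictness for
      \<open>Suc s\<close> comes from the size of \<open>Y\<close>.\<close>
    from N[OF _ \<open>finite V\<close> F large _ this rich] n X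
    have "s * ?n \<le> (k + 1) * card (X - Y)" by fastforce
    moreover have "card X = card (X - Y) + card Y"
      using \<open>Y \<subseteq> X\<close> X \<open>finite V\<close> by (metis card_Diff_subset card_mono finite_subset le_add_diff_inverse2)
    ultimately show "Suc s * ?n < (k + 1) * card X"
      using bigY by (simp add: algebra_simps)
  qed
qed

section \<open>Stability for graphs with few large cliques\<close>

locale finite_simple_graph =
  fixes V :: "'a set" and E :: "'a \<Rightarrow> 'a \<Rightarrow> bool"
  assumes finite_V: "finite V"
    and sym: "E x y \<Longrightarrow> E y x"
    and irrefl: "\<not> E x x"
begin

definition common_nbrs :: "'a set \<Rightarrow> 'a set" where
  "common_nbrs J = {y \<in> V. \<forall>x\<in>J. E x y}"

definition cliques :: "nat \<Rightarrow> 'a set set" where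
  "cliques s = {K. K \<subseteq> V \<and> card K = s \<and> (\<forall>x\<in>K. \<forall>y\<in>K. x \<noteq> y \<longrightarrow> E x y)}"

text \<open>Ordered pairs, so each edge inside \<open>W\<close> counts twice, in line with densities
  relative to \<open>card V ^ 2\<close>.\<close>

definition arcs :: "'a set \<Rightarrow> ('a \<times> 'a) set" where
  "arcs W = (SIGMA x:W. {y \<in> W. E x y})"

text \<open>For \<open>x \<in> K\<close>, the vertices whose only non-neighbour in \<open>K\<close>
  is \<open>x\<close>; if \<open>K\<close> is a clique, \<open>x\<close> is one of them. These
  classes become the parts of the almost partition.\<close>

definition private_nbrs :: "'a set \<Rightarrow> 'a \<Rightarrow> 'a set" where
  "private_nbrs K x = common_nbrs (K - {x}) - common_nbrs K"

lemma finite_common_nbrs [simp]: "finite (common_nbrs J)"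
  using finite_V by (simp add: common_nbrs_def)

lemma finite_cliques [simp]: "finite (cliques s)"
  using finite_V by (auto simp: cliques_def intro: finite_subset[of _ "Pow V"])

lemma finite_clique: "K \<in> cliques s \<Longrightarrow> finite K"
  using finite_V by (auto simp: cliques_def intro: finite_subset)

lemma card_common_nbrs_le: "card (common_nbrs J) \<le> card V"
  using finite_V by (intro card_mono) (auto simp: common_nbrs_def)

lemma common_nbrs_not_mem: "y \<in> common_nbrs J \<Longrightarrow> y \<notin> J"
  using irrefl by (auto simp: common_nbrs_def)

lemma insert_clique:
  "J \<in> cliques s \<Longrightarrow> y \<in> common_nbrs J \<Longrightarrow> insert y J \<in> cliques (Suc s)"
  using common_nbrs_not_mem[of y J] finite_clique[of J s]
  by (auto simp: cliques_def common_nbrs_def intro: sym)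

lemma remove_clique: "K \<in> cliques (Suc s) \<Longrightarrow> x \<in> K \<Longrightarrow> K - {x} \<in> cliques s"
  using finite_clique[of K "Suc s"] by (auto simp: cliques_def)

lemma clique_mem_common_nbrs: "K \<in> cliques s \<Longrightarrow> x \<in> K \<Longrightarrow> x \<in> common_nbrs (K - {x})"
  by (auto simp: cliques_def common_nbrs_def)

text \<open>Removing a marked vertex from a clique and adding a common neighbour to a smaller one
  are inverse operations; the clique counts below come from suitable choices of
  \<open>f\<close>.\<close>

lemma sum_cliques_Suc:
  fixes f :: "'a set \<Rightarrow> 'a \<Rightarrow> 'c::comm_monoid_add"
  shows "(\<Sum>K\<in>cliques (Suc s). \<Sum>x\<in>K. f (K - {x}) x)
    = (\<Sum>J\<in>cliques s. \<Sum>y\<in>common_nbrs J. f J y)"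
proof -
  have "(\<Sum>K\<in>cliques (Suc s). \<Sum>x\<in>K. f (K - {x}) x)
      = (\<Sum>(K, x)\<in>(SIGMA K:cliques (Suc s). K). f (K - {x}) x)"
    by (rule sum.Sigma) (auto simp: finite_clique)
  also have "\<dots> = (\<Sum>(J, y)\<in>(SIGMA J:cliques s. common_nbrs J). f J y)"
    by (rule sum.reindex_bij_witness[where i = "\<lambda>(J, y). (insert y J, y)" and j = "\<lambda>(K, x). (K - {x}, x)"])
      (auto simp: insert_clique remove_clique clique_mem_common_nbrs common_nbrs_not_mem insert_absorb)
  also have "\<dots> = (\<Sum>J\<in>cliques s. \<Sum>y\<in>common_nbrs J. f J y)"
    by (rule sum.Sigma[symmetric]) auto
  finally show ?thesis .
qed

lemma card_cliques_Suc:
  "(\<Sum>J\<in>cliques s. card (common_nbrs J)) = Suc s * card (cliques (Suc s))"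
proof -
  have "(\<Sum>J\<in>cliques s. card (common_nbrs J)) = (\<Sum>K\<in>cliques (Suc s). \<Sum>x\<in>K. 1)"
    by (subst sum_cliques_Suc[of "\<lambda>_ _. 1::nat"]) simp
  also have "\<dots> = (\<Sum>K\<in>cliques (Suc s). Suc s)"
    by (intro sum.cong refl) (simp add: cliques_def)
  finally show ?thesis by simp
qed

lemma sum_card_common_nbrs_square:
  "(\<Sum>K\<in>cliques (Suc s). \<Sum>x\<in>K. card (common_nbrs (K - {x})))
    = (\<Sum>J\<in>cliques s. card (common_nbrs J) ^ 2)"
  by (subst sum_cliques_Suc) (simp add: power2_eq_square)

lemma finite_arcs [simp]: "finite W \<Longrightarrow> finite (arcs W)"
  by (simp add: arcs_def)

lemma arcs_mono: "W \<subseteq> W' \<Longrightarrow> arcs W \<subseteq> arcs W'"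
  by (auto simp: arcs_def)

text \<open>An arc in the common neighbourhood of an \<open>s\<close>-clique extends it to an
  \<open>(s+2)\<close>-clique, and each of these arises once for every ordered pair of distinct
  vertices in it.\<close>

lemma sum_card_arcs_common_nbrs:
  "(\<Sum>J\<in>cliques s. card (arcs (common_nbrs J))) = Suc s * (Suc (Suc s) * card (cliques (Suc (Suc s))))"
proof -
  have "card (arcs (common_nbrs J)) = (\<Sum>y\<in>common_nbrs J. card (common_nbrs (insert y J)))" for J
  proof -
    have "{z \<in> common_nbrs J. E y z} = common_nbrs (insert y J)" for y
      by (auto simp: common_nbrs_def)
    then show ?thesis unfolding arcs_def by (subst card_SigmaI) auto
  qed
  then have "(\<Sum>J\<in>cliques s. card (arcs (common_nbrs J)))
      = (\<Sum>K\<in>cliques (Suc s). \<Sum>x\<in>K. card (common_nbrs (insert x (K - {x}))))"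
    by (simp only: sum_cliques_Suc[of "\<lambda>J y. card (common_nbrs (insert y J))"])
  also have "\<dots> = (\<Sum>K\<in>cliques (Suc s). \<Sum>x\<in>K. card (common_nbrs K))"
    by (intro sum.cong refl) (simp add: insert_absorb)
  also have "\<dots> = (\<Sum>K\<in>cliques (Suc s). Suc s * card (common_nbrs K))"
    by (intro sum.cong refl) (simp add: cliques_def)
  also have "\<dots> = Suc s * (Suc (Suc s) * card (cliques (Suc (Suc s))))"
    by (simp only: sum_distrib_left[symmetric] card_cliques_Suc)
  finally show ?thesis .
qed

lemma cliques_0 [simp]: "cliques 0 = {{}}"
  using finite_V by (auto simp: cliques_def dest: finite_subset)

lemma common_nbrs_empty [simp]: "common_nbrs {} = V"
  by (simp add: common_nbrs_def)

lemma card_cliques_1: "card (cliques (Suc 0)) = card V"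
  using card_cliques_Suc[of 0] by simp

lemma card_arcs_V: "card (arcs V) = 2 * card (cliques 2)"
  using sum_card_arcs_common_nbrs[of 0] by (simp add: numeral_2_eq_2)

lemma disjoint_private_nbrs:
  assumes "x \<in> K" "x' \<in> K" "x \<noteq> x'"
  shows "private_nbrs K x \<inter> private_nbrs K x' = {}"
  using assms by (auto simp: private_nbrs_def common_nbrs_def)

lemma finite_private_nbrs [simp]: "finite (private_nbrs K x)"
  by (simp add: private_nbrs_def)

lemma private_nbrs_subset: "private_nbrs K x \<subseteq> V"
  by (auto simp: private_nbrs_def common_nbrs_def)

lemma card_private_nbrs:
  "card (common_nbrs (K - {x})) = card (private_nbrs K x) + card (common_nbrs K)"
proof -
  have "common_nbrs K \<subseteq> common_nbrs (K - {x})"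
    by (auto simp: common_nbrs_def)
  then show ?thesis
    by (simp add: private_nbrs_def card_Diff_subset card_mono)
qed

lemma sum_card_private_nbrs_le:
  assumes "finite K"
  shows "(\<Sum>x\<in>K. card (private_nbrs K x)) + card (common_nbrs K) \<le> card V"
proof -
  have "(\<Sum>x\<in>K. card (private_nbrs K x)) = card (\<Union>x\<in>K. private_nbrs K x)"
    using assms disjoint_private_nbrs by (subst card_UN_disjoint) auto
  moreover have "card (\<Union>x\<in>K. private_nbrs K x) + card (common_nbrs K)
      = card ((\<Union>x\<in>K. private_nbrs K x) \<union> common_nbrs K)"
    using assms by (subst card_Un_disjoint) (auto simp: private_nbrs_def)
  moreover have "\<dots> \<le> card V"
    using finite_V by (intro card_mono) (auto simp: private_nbrs_def common_nbrs_def)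
  ultimately show ?thesis by simp
qed

text \<open>Over the sets \<open>common_nbrs (K - {x})\<close>, a private neighbour of
  \<open>K\<close> is counted once and a common neighbour \<open>s + 1\<close> times. So if
  \<open>(s+2)\<close>-cliques are few, a large second moment forces large private
  neighbourhoods.\<close>

lemma sum_card_private_nbrs:
  "(\<Sum>K\<in>cliques (Suc s). \<Sum>x\<in>K. card (private_nbrs K x))
     + Suc s * (Suc (Suc s) * card (cliques (Suc (Suc s))))
   = (\<Sum>J\<in>cliques s. card (common_nbrs J) ^ 2)"
proof -
  have "(\<Sum>J\<in>cliques s. card (common_nbrs J) ^ 2)
      = (\<Sum>K\<in>cliques (Suc s). (\<Sum>x\<in>K. card (private_nbrs K x)) + Suc s * card (common_nbrs K))"
    unfolding sum_card_common_nbrs_square[symmetric]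
    by (intro sum.cong refl) (auto simp: card_private_nbrs sum.distrib cliques_def)
  also have "\<dots> = (\<Sum>K\<in>cliques (Suc s). \<Sum>x\<in>K. card (private_nbrs K x))
      + Suc s * (\<Sum>K\<in>cliques (Suc s). card (common_nbrs K))"
    by (simp add: sum.distrib sum_distrib_left)
  finally show ?thesis by (simp only: card_cliques_Suc)
qed

section \<open>The Moon--Moser inequalities\<close>

lemma cliques_Cauchy_Schwarz:
  "(real (Suc s) * real (card (cliques (Suc s))))\<^sup>2
     \<le> real (card (cliques s)) * (\<Sum>J\<in>cliques s. real (card (common_nbrs J)) ^ 2)"
proof -
  have "real (Suc s) * real (card (cliques (Suc s))) = (\<Sum>J\<in>cliques s. real (card (common_nbrs J)))"
    by (metis card_cliques_Suc of_nat_mult of_nat_sum)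
  then show ?thesis
    using sum_squared_le_sum_of_squares[of "\<lambda>J. real (card (common_nbrs J))" "cliques s"]
    by (simp add: mult.commute)
qed

text \<open>For an \<open>(s+1)\<close>-clique \<open>K\<close>, a vertex lies in
  \<open>s + 1\<close> of the sets \<open>common_nbrs (K - {x})\<close> if it is joined to all of
  \<open>K\<close>, and in at most one otherwise. Hence \<open>K\<close> contributes at most
  \<open>card V + s * card (common_nbrs K)\<close>.\<close>

lemma sum_square_le_cliques:
  "(\<Sum>J\<in>cliques s. real (card (common_nbrs J)) ^ 2)
     \<le> real (card V) * real (card (cliques (Suc s)))
       + real s * (real (s + 2) * real (card (cliques (Suc (Suc s)))))"
proof -
  have "(\<Sum>K\<in>cliques (Suc s). (\<Sum>x\<in>K. card (private_nbrs K x)) + card (common_nbrs K))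
      \<le> (\<Sum>K\<in>cliques (Suc s). card V)"
    by (intro sum_mono sum_card_private_nbrs_le finite_clique)
  then have "(\<Sum>K\<in>cliques (Suc s). \<Sum>x\<in>K. card (private_nbrs K x))
      + Suc (Suc s) * card (cliques (Suc (Suc s))) \<le> card (cliques (Suc s)) * card V"
    by (simp add: sum.distrib card_cliques_Suc del: mult_Suc)
  with sum_card_private_nbrs[of s]
  have "(\<Sum>J\<in>cliques s. card (common_nbrs J) ^ 2)
      \<le> card V * card (cliques (Suc s)) + s * ((s + 2) * card (cliques (Suc (Suc s))))"
    by (simp add: algebra_simps)
  then have "real (\<Sum>J\<in>cliques s. card (common_nbrs J) ^ 2)
      \<le> real (card V * card (cliques (Suc s)) + s * ((s + 2) * card (cliques (Suc (Suc s)))))"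
    by (rule of_nat_mono)
  then show ?thesis by (simp add: algebra_simps)
qed

text \<open>Write \<open>c(s)\<close> for the number of \<open>s\<close>-cliques,
  \<open>m = card V\<close> and \<open>r(s) = (s+1) c(s+1) / (m c(s))\<close>. Cauchy--Schwarz
  against the upper bound for the second moment gives \<open>(s+1) r(s) \<le> 1 + s r(s+1)\<close>,
  which propagates \<open>r(s) \<ge> 1 - s/k - s \<eta>\<close> from the edge density. The bound on
  \<open>\<eta>\<close> keeps this positive for \<open>s < k\<close>, so no clique count
  vanishes.\<close>

lemma Moon_Moser:
  assumes "k \<ge> 2" "0 \<le> \<eta>" "\<eta> \<le> 1 / (2 * real k ^ 2)" "V \<noteq> {}"
    and dense: "(1 - 1 / real k - \<eta>) * real (card V) ^ 2 \<le> real (card (arcs V))"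
  shows "1 \<le> s \<Longrightarrow> s < k \<Longrightarrow> 0 < card (cliques s) \<and>
    real (card V) * (1 - real s / real k - real s * \<eta>) * real (card (cliques s))
      \<le> real (Suc s) * real (card (cliques (Suc s)))"
proof (induction s rule: nat_induct_at_least)
  case base
  have "0 < card V" using \<open>V \<noteq> {}\<close> finite_V by (simp add: card_gt_0_iff)
  with dense show ?case
    by (simp add: card_cliques_1 card_arcs_V power2_eq_square numeral_2_eq_2 algebra_simps)
next
  case (Suc s)
  let ?m = "real (card V)" and ?c = "\<lambda>s. real (card (cliques s))"
  let ?b = "1 - real s / real k - real s * \<eta>"
  let ?b' = "1 - real (Suc s) / real k - real (Suc s) * \<eta>"
  have "0 < ?m" using \<open>V \<noteq> {}\<close> finite_V by (simp add: card_gt_0_iff)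
  from Suc have IH: "0 < ?c s" "?m * ?b * ?c s \<le> real (Suc s) * ?c (Suc s)"
    and "s < k" by auto
  have "real s * \<eta> \<le> real k * \<eta>"
    using \<open>s < k\<close> assms(2) by (intro mult_right_mono) auto
  moreover have "real k * \<eta> \<le> 1 / (2 * real k)"
  proof -
    have "real k * \<eta> \<le> real k * (1 / (2 * real k ^ 2))"
      using assms by (intro mult_left_mono) auto
    also have "\<dots> = 1 / (2 * real k)" by (simp add: power2_eq_square)
    finally show ?thesis .
  qed
  moreover have "real s / real k + 1 / real k \<le> 1"
    using \<open>s < k\<close> by (simp add: field_simps)
  moreover have "1 / (2 * real k) < 1 / real k" using \<open>k \<ge> 2\<close> by (simp add: field_simps)
  ultimately have "0 < ?b" by linarith
  then have "0 < ?m * ?b * ?c s" using IH \<open>0 < ?m\<close> by simp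
  with IH have "0 < real (Suc s) * ?c (Suc s)" by linarith
  then have pos: "0 < ?c (Suc s)" by (simp add: zero_less_mult_iff)
  have "(?m * ?b * ?c s) * (real (Suc s) * ?c (Suc s)) \<le> (real (Suc s) * ?c (Suc s))\<^sup>2"
    unfolding power2_eq_square using IH by (intro mult_right_mono) auto
  also have "\<dots> \<le> ?c s * (?m * ?c (Suc s) + real s * (real (s + 2) * ?c (Suc (Suc s))))"
    by (rule order_trans[OF cliques_Cauchy_Schwarz]) (intro mult_left_mono sum_square_le_cliques, simp)
  finally have "?c s * (?m * ?b * (real (Suc s) * ?c (Suc s)))
      \<le> ?c s * (?m * ?c (Suc s) + real s * (real (s + 2) * ?c (Suc (Suc s))))"
    by (simp add: mult_ac)
  then have "?m * ?b * (real (Suc s) * ?c (Suc s))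
      \<le> ?m * ?c (Suc s) + real s * (real (s + 2) * ?c (Suc (Suc s)))"
    using IH(1) by (simp only: mult_le_cancel_left_pos)
  moreover have "?m * ?b * (real (Suc s) * ?c (Suc s)) - ?m * ?c (Suc s)
      = real s * (?m * ?b' * ?c (Suc s))"
    using \<open>k \<ge> 2\<close> by (simp add: field_simps)
  ultimately have "real s * (?m * ?b' * ?c (Suc s)) \<le> real s * (real (s + 2) * ?c (Suc (Suc s)))"
    by linarith
  then have "?m * ?b' * ?c (Suc s) \<le> real (s + 2) * ?c (Suc (Suc s))"
    using \<open>1 \<le> s\<close> by (subst (asm) mult_le_cancel_left_pos) auto
  with pos show ?case by simp
qed

text \<open>For \<open>s < k\<close> the Moon--Moser factor is at least \<open>1 / (2k)\<close>, so
  each step multiplies the clique count by at least \<open>m / (2k^2)\<close>.\<close>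

lemma card_cliques_ge:
  assumes "k \<ge> 2" "0 \<le> \<eta>" "\<eta> \<le> 1 / (2 * real k ^ 2)" "V \<noteq> {}"
    and dense: "(1 - 1 / real k - \<eta>) * real (card V) ^ 2 \<le> real (card (arcs V))"
  shows "1 \<le> s \<Longrightarrow> s \<le> k \<Longrightarrow> (real (card V) / (2 * real k ^ 2)) ^ s \<le> real (card (cliques s))"
proof (induction s rule: nat_induct_at_least)
  case base
  have "1 \<le> real k ^ 2" using \<open>k \<ge> 2\<close> by (intro one_le_power) simp
  then have "real (card V) / (2 * real k ^ 2) \<le> real (card V)"
    by (simp add: divide_le_eq mult_left_le mult_le_cancel_left1)
  then show ?case by (simp add: card_cliques_1)
next
  case (Suc s)
  let ?m = "real (card V)" and ?c = "\<lambda>s. real (card (cliques s))"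
  let ?b = "1 - real s / real k - real s * \<eta>"
  have "s < k" using Suc by simp
  have MM: "?m * ?b * ?c s \<le> real (Suc s) * ?c (Suc s)"
    using Moon_Moser[OF assms Suc(1) \<open>s < k\<close>] by simp
  have "1 / (2 * real k) \<le> ?b"
  proof -
    have "real s * \<eta> \<le> real k * (1 / (2 * real k ^ 2))"
      using assms \<open>s < k\<close> by (intro mult_mono) auto
    also have "\<dots> = 1 / (2 * real k)" by (simp add: power2_eq_square)
    finally show ?thesis using \<open>s < k\<close> by (simp add: field_simps)
  qed
  then have "?m * (1 / (2 * real k)) * ?c s \<le> ?m * ?b * ?c s"
    by (intro mult_right_mono mult_left_mono) auto
  also note MM
  also have "real (Suc s) * ?c (Suc s) \<le> real k * ?c (Suc s)"
    using \<open>s < k\<close> by (intro mult_right_mono) auto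
  finally have "?m / (2 * real k ^ 2) * ?c s \<le> ?c (Suc s)"
    using \<open>k \<ge> 2\<close> by (simp add: field_simps power2_eq_square)
  moreover have "?m / (2 * real k ^ 2) * (?m / (2 * real k ^ 2)) ^ s \<le> ?m / (2 * real k ^ 2) * ?c s"
    using Suc \<open>s < k\<close> by (intro mult_left_mono) auto
  ultimately show ?case by simp
qed

section \<open>Almost partitions of near-extremal graphs\<close>

text \<open>Average over all \<open>k\<close>-cliques \<open>K\<close>. The second moment for
  \<open>(k-1)\<close>-cliques is so large that the private neighbourhoods cover nearly all of
  \<open>V\<close> on average, and an arc inside one of them completes a
  \<open>(k+1)\<close>-clique, of which there are few. Adding both defects on the scale
  \<open>m^2\<close> lets a single \<open>K\<close> control both.\<close>

lemma near_Turan_partition: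
  assumes "k \<ge> 2" "0 \<le> \<eta>" "\<eta> \<le> 1 / (2 * real k ^ 2)" "V \<noteq> {}"
    and dense: "(1 - 1 / real k - \<eta>) * real (card V) ^ 2 \<le> real (card (arcs V))"
    and few: "real (card (cliques (Suc k))) \<le> \<gamma> * real (card V) ^ Suc k"
  shows "\<exists>K\<in>cliques k. real (card V) * (real (card V) - (\<Sum>x\<in>K. real (card (private_nbrs K x))))
      + (\<Sum>x\<in>K. real (card (arcs (private_nbrs K x))))
    \<le> (real k ^ 2 * \<eta> + 2 * real k * real (k + 1) * \<gamma> * (2 * real k ^ 2) ^ k) * real (card V) ^ 2"
proof (rule ccontr)
  let ?m = "real (card V)" and ?c = "\<lambda>s. real (card (cliques s))"
  let ?w = "\<lambda>K. \<Sum>x\<in>K. real (card (private_nbrs K x))"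
  let ?e = "\<lambda>K. \<Sum>x\<in>K. real (card (arcs (private_nbrs K x)))"
  let ?C = "real k ^ 2 * \<eta> + 2 * real k * real (k + 1) * \<gamma> * (2 * real k ^ 2) ^ k"
  assume "\<not> ?thesis"
  then have big: "?C * ?m ^ 2 < ?m * (?m - ?w K) + ?e K" if "K \<in> cliques k" for K
    using that by force
  obtain s where k: "k = Suc s" "1 \<le> s" using \<open>k \<ge> 2\<close> by (cases k) auto
  have "0 < ?m" using \<open>V \<noteq> {}\<close> finite_V by (simp add: card_gt_0_iff)
  have ck: "(?m / (2 * real k ^ 2)) ^ k \<le> ?c k"
    using card_cliques_ge[OF assms(1-5)] \<open>k \<ge> 2\<close> by simp
  moreover have "0 < (?m / (2 * real k ^ 2)) ^ k" using \<open>0 < ?m\<close> \<open>k \<ge> 2\<close> by simp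
  ultimately have "0 < ?c k" by linarith
  have cs: "0 < ?c s" "?m * (1 - real s / real k - real s * \<eta>) * ?c s \<le> real k * ?c k"
    using Moon_Moser[OF assms(1-5), of s] k by auto
  define Q where "Q = (\<Sum>J\<in>cliques s. real (card (common_nbrs J)) ^ 2)"
  \<comment> \<open>Cauchy--Schwarz combined with Moon--Moser at \<open>s = k - 1\<close>, where
    \<open>k (1 - s/k - s \<eta>) = 1 - k s \<eta>\<close>.\<close>
  have "?c s * (?m * (1 - real s / real k - real s * \<eta>) * (real k * ?c k)) \<le> (real k * ?c k)\<^sup>2"
    unfolding power2_eq_square using mult_right_mono[OF cs(2), of "real k * ?c k"] by (simp add: mult_ac)
  also have "\<dots> \<le> ?c s * Q"
    using cliques_Cauchy_Schwarz[of s] by (simp add: k Q_def)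
  finally have "?m * (1 - real s / real k - real s * \<eta>) * (real k * ?c k) \<le> Q"
    using cs(1) by (simp only: mult_le_cancel_left_pos)
  moreover have "?m * (1 - real s / real k - real s * \<eta>) * (real k * ?c k)
      = ?m * ?c k * (1 - real k * real s * \<eta>)"
    using k by (simp add: field_simps)
  moreover have "?m * ?c k * (1 - real k ^ 2 * \<eta>) \<le> ?m * ?c k * (1 - real k * real s * \<eta>)"
    using k \<open>0 \<le> \<eta>\<close> by (intro mult_left_mono) (auto simp: power2_eq_square intro!: mult_mono)
  ultimately have Q: "?m * ?c k * (1 - real k ^ 2 * \<eta>) \<le> Q" by linarith
  have "real ((\<Sum>K\<in>cliques (Suc s). \<Sum>x\<in>K. card (private_nbrs K x))
     + Suc s * (Suc (Suc s) * card (cliques (Suc (Suc s))))) = Q"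
    unfolding sum_card_private_nbrs Q_def by simp
  then have w: "(\<Sum>K\<in>cliques k. ?w K) = Q - real k * (real (k + 1) * ?c (Suc k))"
    by (simp add: k algebra_simps)
  \<comment> \<open>Each \<open>(k-1)\<close>-clique \<open>J\<close> arises from
    \<open>card (common_nbrs J)\<close>, hence at most \<open>m\<close>, pairs
    \<open>(K, x)\<close>.\<close>
  have "(\<Sum>K\<in>cliques k. ?e K) \<le> (\<Sum>K\<in>cliques k. \<Sum>x\<in>K. real (card (arcs (common_nbrs (K - {x})))))"
    by (intro sum_mono of_nat_mono card_mono arcs_mono) (auto simp: private_nbrs_def)
  also have "\<dots> = (\<Sum>J\<in>cliques s. real (card (common_nbrs J)) * real (card (arcs (common_nbrs J))))"
    unfolding k by (subst sum_cliques_Suc) simp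
  also have "\<dots> \<le> (\<Sum>J\<in>cliques s. ?m * real (card (arcs (common_nbrs J))))"
    by (intro sum_mono mult_right_mono) (auto simp: card_common_nbrs_le)
  also have "\<dots> = ?m * real (\<Sum>J\<in>cliques s. card (arcs (common_nbrs J)))"
    by (simp add: sum_distrib_left)
  also have "\<dots> = ?m * (real k * (real (k + 1) * ?c (Suc k)))"
    unfolding sum_card_arcs_common_nbrs by (simp add: k algebra_simps)
  finally have e: "(\<Sum>K\<in>cliques k. ?e K) \<le> ?m * (real k * (real (k + 1) * ?c (Suc k)))" .
  \<comment> \<open>The lower bound on the number of \<open>k\<close>-cliques makes the error
    relative to \<open>m c(k)\<close> instead of \<open>m^(k+1)\<close>.\<close>
  have few': "?c (Suc k) \<le> \<gamma> * (2 * real k ^ 2) ^ k * ?m * ?c k"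
  proof -
    have "0 \<le> \<gamma> * ?m ^ Suc k" using few by (meson of_nat_0_le_iff order_trans)
    moreover have "0 < ?m ^ Suc k" using \<open>0 < ?m\<close> by (rule zero_less_power)
    ultimately have "0 \<le> \<gamma>" by (meson mult_neg_pos not_le)
    have "?m ^ Suc k = (2 * real k ^ 2) ^ k * ?m * (?m / (2 * real k ^ 2)) ^ k"
      using \<open>k \<ge> 2\<close> by (simp add: power_divide)
    then have "?c (Suc k) \<le> \<gamma> * (2 * real k ^ 2) ^ k * ?m * (?m / (2 * real k ^ 2)) ^ k"
      using few by (simp only: mult.assoc)
    also have "\<dots> \<le> \<gamma> * (2 * real k ^ 2) ^ k * ?m * ?c k"
      using ck \<open>0 \<le> \<gamma>\<close> by (intro mult_left_mono) auto
    finally show ?thesis .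
  qed
  have "?c k * (?C * ?m ^ 2) = (\<Sum>K\<in>cliques k. ?C * ?m ^ 2)" by simp
  also have "\<dots> < (\<Sum>K\<in>cliques k. ?m * (?m - ?w K) + ?e K)"
    using big \<open>0 < ?c k\<close> by (intro sum_strict_mono) (auto simp: card_gt_0_iff)
  also have "\<dots> = ?m * (?c k * ?m - (\<Sum>K\<in>cliques k. ?w K)) + (\<Sum>K\<in>cliques k. ?e K)"
    by (simp add: sum.distrib sum_subtractf sum_distrib_left right_diff_distrib)
  also have "\<dots> \<le> ?m * (?c k * ?m - (?m * ?c k * (1 - real k ^ 2 * \<eta>) - real k * (real (k + 1) * ?c (Suc k))))
      + ?m * (real k * (real (k + 1) * ?c (Suc k)))"
    using Q w \<open>0 < ?m\<close> by (intro add_mono e mult_left_mono) auto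
  also have "\<dots> = ?m ^ 2 * ?c k * (real k ^ 2 * \<eta>) + 2 * ?m * real k * real (k + 1) * ?c (Suc k)"
    by (simp add: algebra_simps power2_eq_square)
  also have "\<dots> \<le> ?m ^ 2 * ?c k * (real k ^ 2 * \<eta>)
      + 2 * ?m * real k * real (k + 1) * (\<gamma> * (2 * real k ^ 2) ^ k * ?m * ?c k)"
    using few' by (intro add_left_mono mult_left_mono) auto
  also have "\<dots> = ?c k * (?C * ?m ^ 2)"
    by (simp add: algebra_simps power2_eq_square)
  finally show False by simp
qed

text \<open>An arc has an end outside the parts, lies within a part, or is a cross pair outside the
  set \<open>X\<close> of missing cross pairs. Hence the edge density bounds
  \<open>sq + card X\<close> by about \<open>m^2 / k\<close>, with \<open>sq\<close> the sum of the
  squared part sizes. Cauchy--Schwarz bounds \<open>sq\<close> below by nearly as much, so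
  \<open>X\<close> is small and the part sizes have small variance.\<close>

lemma near_Turan_parts:
  fixes W :: "'i \<Rightarrow> 'a set"
  assumes "finite I" "card I = k" "k \<ge> 1" and W: "\<And>i. i \<in> I \<Longrightarrow> W i \<subseteq> V"
    and disj: "\<And>i j. i \<in> I \<Longrightarrow> j \<in> I \<Longrightarrow> i \<noteq> j \<Longrightarrow> W i \<inter> W j = {}"
    and dense: "(1 - 1 / real k - \<eta>) * real (card V) ^ 2 \<le> real (card (arcs V))"
    and cover: "(1 - \<delta>) * real (card V) \<le> (\<Sum>i\<in>I. real (card (W i)))"
    and inner: "(\<Sum>i\<in>I. real (card (arcs (W i)))) \<le> \<delta> * real (card V) ^ 2"
    and "\<eta> \<le> \<delta>" "6 * \<delta> \<le> \<beta> ^ 2" "0 \<le> \<delta>" "\<delta> \<le> 1" "0 \<le> \<beta>" "\<beta> \<le> 1"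
  shows "i \<in> I \<Longrightarrow> (1 / real k - \<beta>) * real (card V) \<le> real (card (W i))"
    and "i \<in> I \<Longrightarrow> j \<in> I \<Longrightarrow> i \<noteq> j \<Longrightarrow>
      real (card {(x, y) \<in> W i \<times> W j. \<not> E x y}) \<le> \<beta> * real (card V) ^ 2"
proof -
  let ?m = "real (card V)" and ?w = "\<lambda>i. real (card (W i))"
  define U where "U = (\<Union>i\<in>I. W i)"
  define D where "D = (\<Union>i\<in>I. W i \<times> W i)"
  define X where "X = {(x, y) \<in> U \<times> U - D. \<not> E x y}"
  define sw where "sw = (\<Sum>i\<in>I. ?w i)"
  define sq where "sq = (\<Sum>i\<in>I. ?w i ^ 2)"
  have finW: "finite (W i)" if "i \<in> I" for i
    using W[OF that] finite_V by (rule finite_subset)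
  have "U \<subseteq> V" using W by (auto simp: U_def)
  then have "finite U" using finite_V by (rule finite_subset)
  have "D \<subseteq> U \<times> U" by (auto simp: U_def D_def)
  then have "finite D" using \<open>finite U\<close> by (meson finite_SigmaI finite_subset)
  have cardU: "real (card U) = sw"
    unfolding U_def sw_def using \<open>finite I\<close> finW disj by (subst card_UN_disjoint) auto
  have "card D = (\<Sum>i\<in>I. card (W i \<times> W i))"
    unfolding D_def
  proof (rule card_UN_disjoint)
    show "\<forall>i\<in>I. \<forall>j\<in>I. i \<noteq> j \<longrightarrow> (W i \<times> W i) \<inter> (W j \<times> W j) = {}"
      using disj by blast
  qed (use \<open>finite I\<close> finW in auto)
  then have cardD: "real (card D) = sq"
    by (simp add: sq_def card_cartesian_product power2_eq_square)
  have "sw \<le> ?m"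
    unfolding cardU[symmetric] using \<open>U \<subseteq> V\<close> finite_V by (simp add: card_mono)
  have "0 \<le> sw" by (simp add: sw_def sum_nonneg)
  have "finite X" using \<open>finite U\<close> by (auto simp: X_def intro: finite_subset[of _ "U \<times> U"])
  have X_sub: "X \<subseteq> U \<times> U - D" by (auto simp: X_def)
  have "arcs V \<subseteq> V \<times> (V - U) \<union> (V - U) \<times> V \<union> (\<Union>i\<in>I. arcs (W i)) \<union> ((U \<times> U - D) - X)"
    by (auto simp: arcs_def X_def U_def D_def)
  then have "card (arcs V) \<le> card (V \<times> (V - U) \<union> (V - U) \<times> V \<union> (\<Union>i\<in>I. arcs (W i)) \<union> ((U \<times> U - D) - X))"
    using finite_V \<open>finite U\<close> \<open>finite I\<close> finW by (intro card_mono) auto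
  also have "\<dots> \<le> card (V \<times> (V - U)) + card ((V - U) \<times> V) + (\<Sum>i\<in>I. card (arcs (W i)))
      + card ((U \<times> U - D) - X)"
    by (intro order_trans[OF card_Un_le] add_mono card_UN_le \<open>finite I\<close> order_refl)
  finally have "real (card (arcs V)) \<le> real (card (V \<times> (V - U)) + card ((V - U) \<times> V)
      + (\<Sum>i\<in>I. card (arcs (W i))) + card ((U \<times> U - D) - X))"
    by (rule of_nat_mono)
  moreover have "real (card (V - U)) = ?m - sw"
    using \<open>U \<subseteq> V\<close> finite_V \<open>finite U\<close> by (simp add: card_Diff_subset of_nat_diff card_mono cardU[symmetric])
  moreover have "real (card (U \<times> U - D - X)) = sw ^ 2 - sq - real (card X)"
  proof -
    have "card (U \<times> U - D) + card D = card U * card U"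
      using card_Diff_subset[OF \<open>finite D\<close> \<open>D \<subseteq> U \<times> U\<close>] card_mono[OF _ \<open>D \<subseteq> U \<times> U\<close>] \<open>finite U\<close>
      by (simp add: card_cartesian_product)
    moreover have "card (U \<times> U - D - X) + card X = card (U \<times> U - D)"
      using card_Diff_subset[OF \<open>finite X\<close> X_sub] card_mono[OF _ X_sub] \<open>finite U\<close> by simp
    ultimately have "card (U \<times> U - D - X) + card X + card D = card U * card U" by simp
    then have "real (card (U \<times> U - D - X)) + real (card X) + real (card D) = real (card U) * real (card U)"
      by (metis of_nat_add of_nat_mult)
    then show ?thesis by (simp add: cardU cardD power2_eq_square)
  qed
  ultimately have "real (card (arcs V)) \<le> 2 * ?m * (?m - sw) + (\<Sum>i\<in>I. real (card (arcs (W i))))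
      + (sw ^ 2 - sq - real (card X))"
    by (simp add: card_cartesian_product)
  moreover have "2 * ?m * (?m - sw) \<le> 2 * \<delta> * ?m ^ 2"
    using mult_left_mono[OF cover, of "2 * ?m"] by (simp add: sw_def algebra_simps power2_eq_square)
  \<comment> \<open>Of the \<open>3 * \<delta>\<close>, two pay for arcs leaving the parts and one
    for arcs within a part.\<close>
  ultimately have count: "(1 - 1 / real k - \<eta>) * ?m ^ 2 + sq + real (card X) \<le> 3 * \<delta> * ?m ^ 2 + sw ^ 2"
    using dense inner by linarith
  have "sw ^ 2 \<le> ?m ^ 2" using \<open>sw \<le> ?m\<close> \<open>0 \<le> sw\<close> by (intro power_mono) auto
  have "0 < real k" using \<open>k \<ge> 1\<close> by simp
  have bound: "sq + real (card X) \<le> (1 / real k + 4 * \<delta>) * ?m ^ 2"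
  proof -
    have "\<eta> * ?m ^ 2 \<le> \<delta> * ?m ^ 2" using \<open>\<eta> \<le> \<delta>\<close> by (intro mult_right_mono) auto
    with count \<open>sw ^ 2 \<le> ?m ^ 2\<close> show ?thesis by (simp add: algebra_simps)
  qed
  have "(1 - 2 * \<delta>) * ?m ^ 2 \<le> ((1 - \<delta>) * ?m) ^ 2"
    using mult_nonneg_nonneg[of "\<delta> ^ 2" "?m ^ 2"] by (simp add: power2_eq_square algebra_simps)
  also have "\<dots> \<le> sw ^ 2"
    using cover \<open>\<delta> \<le> 1\<close> by (intro power_mono) (auto simp: sw_def)
  also have "\<dots> \<le> real k * sq"
    using sum_squared_le_sum_of_squares[of ?w I] \<open>card I = k\<close>
    by (simp add: sw_def sq_def mult.commute)
  finally have "(1 - 2 * \<delta>) * ?m ^ 2 / real k \<le> sq"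
    using \<open>0 < real k\<close> by (simp add: field_simps)
  moreover have "2 * \<delta> * ?m ^ 2 / real k \<le> 2 * \<delta> * ?m ^ 2"
    using \<open>k \<ge> 1\<close> \<open>0 \<le> \<delta>\<close> mult_left_mono[of 1 "real k" "2 * \<delta> * ?m ^ 2"]
    by (simp add: divide_le_eq)
  ultimately have "real (card X) \<le> 6 * \<delta> * ?m ^ 2"
    using bound by (simp add: algebra_simps diff_divide_distrib)
  also have "\<dots> \<le> \<beta> ^ 2 * ?m ^ 2" using \<open>6 * \<delta> \<le> \<beta> ^ 2\<close> by (intro mult_right_mono) auto
  also have "\<dots> \<le> \<beta> * ?m ^ 2"
    using \<open>0 \<le> \<beta>\<close> \<open>\<beta> \<le> 1\<close> by (intro mult_right_mono) (auto simp: power2_eq_square mult_left_le)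
  finally have cardX: "real (card X) \<le> \<beta> * ?m ^ 2" .
  show "real (card {(x, y) \<in> W i \<times> W j. \<not> E x y}) \<le> \<beta> * ?m ^ 2"
    if "i \<in> I" "j \<in> I" "i \<noteq> j" for i j
  proof -
    have "(x, y) \<notin> D" if xy: "x \<in> W i" "y \<in> W j" for x y
    proof
      assume "(x, y) \<in> D"
      then obtain l where "l \<in> I" "x \<in> W l" "y \<in> W l" by (auto simp: D_def)
      with disj[of i l] disj[of j l] xy \<open>i \<in> I\<close> \<open>j \<in> I\<close> \<open>i \<noteq> j\<close> show False by blast
    qed
    then have "{(x, y) \<in> W i \<times> W j. \<not> E x y} \<subseteq> X"
      using that by (auto simp: X_def U_def)
    then have "card {(x, y) \<in> W i \<times> W j. \<not> E x y} \<le> card X"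
      using \<open>finite X\<close> by (intro card_mono)
    with cardX show ?thesis by linarith
  qed
  show "(1 / real k - \<beta>) * ?m \<le> ?w i" if "i \<in> I" for i
  proof -
    \<comment> \<open>Sum of squared deviations from \<open>m / k\<close>: the upper bound on
      \<open>sq\<close> and the lower bound on \<open>sw\<close> make it at most
      \<open>6 \<delta> m^2\<close>.\<close>
    have "(?w i - ?m / real k) ^ 2 \<le> (\<Sum>j\<in>I. (?w j - ?m / real k) ^ 2)"
      using that \<open>finite I\<close> by (intro member_le_sum) auto
    also have "\<dots> = sq - 2 * (?m / real k) * sw + real k * (?m / real k) ^ 2"
      by (simp add: power2_diff sum.distrib sum_subtractf sum_distrib_left sum_distrib_right
          sum_divide_distrib sq_def sw_def \<open>card I = k\<close> mult_ac)
    also have "\<dots> = sq - 2 * (?m / real k) * sw + ?m ^ 2 / real k"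
      using \<open>0 < real k\<close> by (simp add: power2_eq_square)
    also have "\<dots> \<le> (1 / real k + 4 * \<delta>) * ?m ^ 2 - 2 * (?m / real k) * ((1 - \<delta>) * ?m) + ?m ^ 2 / real k"
    proof -
      have "2 * (?m / real k) * ((1 - \<delta>) * ?m) \<le> 2 * (?m / real k) * sw"
        using cover by (intro mult_left_mono) (auto simp: sw_def)
      with bound show ?thesis by simp
    qed
    also have "\<dots> = 4 * \<delta> * ?m ^ 2 + 2 * \<delta> * ?m ^ 2 / real k"
      using \<open>0 < real k\<close> by (simp add: field_simps power2_eq_square)
    also have "\<dots> \<le> 6 * \<delta> * ?m ^ 2"
      using \<open>2 * \<delta> * ?m ^ 2 / real k \<le> 2 * \<delta> * ?m ^ 2\<close> by simp
    also have "\<dots> \<le> \<beta> ^ 2 * ?m ^ 2" using \<open>6 * \<delta> \<le> \<beta> ^ 2\<close> by (intro mult_right_mono) auto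
    finally have "(?w i - ?m / real k) ^ 2 \<le> (\<beta> * ?m) ^ 2" by (simp add: power_mult_distrib)
    then have "\<bar>?w i - ?m / real k\<bar> \<le> \<bar>\<beta> * ?m\<bar>"
      by (simp only: abs_le_square_iff)
    moreover have "\<bar>\<beta> * ?m\<bar> = \<beta> * ?m" using \<open>0 \<le> \<beta>\<close> by simp
    ultimately have "?m / real k - \<beta> * ?m \<le> ?w i" by linarith
    then show ?thesis by (simp add: left_diff_distrib)
  qed
qed

end

section \<open>Nearly cross-disjoint families\<close>

text \<open>Each point contributes an independent factor, \<open>2\<close> on \<open>U\<close> and
  \<open>1 + c\<close> on \<open>R\<close>. The value is the normalising constant of the weighted
  distribution used next.\<close>

lemma sum_Pow_power_card_Int:
  fixes c :: real
  assumes "finite R" "finite U" "U \<inter> R = {}"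
  shows "(\<Sum>A\<in>Pow (U \<union> R). c ^ card (A \<inter> R)) = 2 ^ card U * (1 + c) ^ card R"
  using assms
proof (induction R rule: finite_induct)
  case empty
  then show ?case by (simp add: card_Pow)
next
  case (insert x R)
  let ?P = "Pow (U \<union> R)"
  have x: "x \<notin> U \<union> R" using insert by auto
  have "inj_on (insert x) ?P"
    using x by (auto simp: inj_on_def)
  have split: "Pow (U \<union> insert x R) = ?P \<union> insert x ` ?P"
    by (simp add: Pow_insert)
  have "?P \<inter> insert x ` ?P = {}" using x by auto
  then have "(\<Sum>A\<in>Pow (U \<union> insert x R). c ^ card (A \<inter> insert x R))
      = (\<Sum>A\<in>?P. c ^ card (A \<inter> insert x R)) + (\<Sum>A\<in>?P. c ^ card (insert x A \<inter> insert x R))"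
    unfolding split using insert \<open>inj_on (insert x) ?P\<close>
    by (simp add: sum.union_disjoint sum.reindex)
  also have "(\<Sum>A\<in>?P. c ^ card (A \<inter> insert x R)) = (\<Sum>A\<in>?P. c ^ card (A \<inter> R))"
    using x by (intro sum.cong refl) (auto intro!: arg_cong[of _ _ "\<lambda>B. c ^ card B"])
  also have "(\<Sum>A\<in>?P. c ^ card (insert x A \<inter> insert x R)) = (\<Sum>A\<in>?P. c * c ^ card (A \<inter> R))"
  proof (intro sum.cong refl)
    fix A assume "A \<in> ?P"
    have "insert x A \<inter> insert x R = insert x (A \<inter> R)" by auto
    moreover have "x \<notin> A \<inter> R" "finite (A \<inter> R)" using x insert by auto
    ultimately show "c ^ card (insert x A \<inter> insert x R) = c * c ^ card (A \<inter> R)" by simp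
  qed
  finally show ?case
    using insert by (simp add: sum_distrib_left[symmetric] algebra_simps)
qed

text \<open>Compare the uniform distribution on \<open>G\<close> with the distribution on
  \<open>Pow (U \<union> R)\<close> proportional to \<open>c ^ card (A \<inter> R)\<close>, via Gibbs' inequality.\<close>
lemma ln_card_le_sparse_part:
  fixes c \<tau> :: real
  assumes "finite R" "finite U" "U \<inter> R = {}" and G: "G \<subseteq> Pow (U \<union> R)" "G \<noteq> {}"
    and c: "0 < c" "c \<le> 1"
    and sparse: "\<And>x. x \<in> R \<Longrightarrow> real (card {A \<in> G. x \<in> A}) \<le> \<tau> * real (card G)"
  shows "ln (real (card G)) \<le> real (card U) * ln 2 + real (card R) * (ln (1 + c) + \<tau> * ln (1 / c))"
proof -
  let ?g = "real (card G)" and ?Z = "2 ^ card U * (1 + c) ^ card R"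
  have "finite G" using G assms(1,2) by (meson finite_Pow_iff finite_UnI finite_subset)
  then have "?g > 0" using G by (simp add: card_gt_0_iff)
  have "?Z > 0" using c by simp
  define S where "S = (\<Sum>A\<in>G. real (card (A \<inter> R)))"
  have "S = (\<Sum>A\<in>G. \<Sum>x\<in>R. if x \<in> A then 1 else 0)"
    unfolding S_def using \<open>finite R\<close>
    by (intro sum.cong refl) (simp add: sum.If_cases Int_def conj_commute)
  also have "\<dots> = (\<Sum>x\<in>R. \<Sum>A\<in>G. if x \<in> A then 1 else 0)"
    by (rule sum.swap)
  also have "\<dots> = (\<Sum>x\<in>R. real (card {A \<in> G. x \<in> A}))"
    using \<open>finite G\<close> by (intro sum.cong refl) (simp add: sum.If_cases Int_def)
  also have "\<dots> \<le> (\<Sum>x\<in>R. \<tau> * ?g)"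
    by (intro sum_mono sparse)
  finally have S: "S \<le> real (card R) * (\<tau> * ?g)" by simp
  \<comment> \<open>\<open>ln x \<le> x - 1\<close> for the ratio \<open>x\<close> of the weighted
    probability of \<open>A\<close> to its uniform probability \<open>1 / card G\<close>; summed
    over \<open>G\<close>, the right side is at most 0.\<close>
  have gibbs: "ln ?g + real (card (A \<inter> R)) * ln c - ln ?Z \<le> ?g * (c ^ card (A \<inter> R) / ?Z) - 1" for A
  proof -
    have "ln (?g * (c ^ card (A \<inter> R) / ?Z)) \<le> ?g * (c ^ card (A \<inter> R) / ?Z) - 1"
      using \<open>?g > 0\<close> \<open>?Z > 0\<close> c by (intro ln_le_minus_one mult_pos_pos divide_pos_pos) auto
    moreover have "ln (?g * (c ^ card (A \<inter> R) / ?Z)) = ln ?g + (ln (c ^ card (A \<inter> R)) - ln ?Z)"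
      using \<open>?g > 0\<close> \<open>?Z > 0\<close> c by (subst ln_mult, simp, simp, subst ln_div) auto
    ultimately show ?thesis using c by (simp add: ln_realpow)
  qed
  have "?g * ln ?g + S * ln c - ?g * ln ?Z = (\<Sum>A\<in>G. ln ?g + real (card (A \<inter> R)) * ln c - ln ?Z)"
    by (simp add: S_def sum.distrib sum_subtractf sum_distrib_right)
  also have "\<dots> \<le> (\<Sum>A\<in>G. ?g * (c ^ card (A \<inter> R) / ?Z) - 1)"
    by (intro sum_mono gibbs)
  also have "\<dots> = ?g * ((\<Sum>A\<in>G. c ^ card (A \<inter> R)) / ?Z) - ?g"
    by (simp only: sum_subtractf sum_distrib_left sum_divide_distrib) simp
  also have "\<dots> \<le> ?g * (?Z / ?Z) - ?g"
  proof -
    have "(\<Sum>A\<in>G. c ^ card (A \<inter> R)) \<le> (\<Sum>A\<in>Pow (U \<union> R). c ^ card (A \<inter> R))"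
      using G assms(1,2) c by (intro sum_mono2) auto
    then have "(\<Sum>A\<in>G. c ^ card (A \<inter> R)) \<le> ?Z"
      using sum_Pow_power_card_Int[OF assms(1-3)] by simp
    then show ?thesis using \<open>?Z > 0\<close> \<open>?g > 0\<close>
      by (intro diff_right_mono mult_left_mono divide_right_mono) auto
  qed
  also have "\<dots> = 0" using c by simp
  finally have "?g * ln ?g \<le> ?g * ln ?Z + S * ln (1 / c)"
    using c by (simp add: ln_div)
  also have "S * ln (1 / c) \<le> (real (card R) * (\<tau> * ?g)) * ln (1 / c)"
    using S c by (intro mult_right_mono) auto
  finally have "?g * ln ?g \<le> ?g * (ln ?Z + real (card R) * \<tau> * ln (1 / c))"
    by (simp add: algebra_simps)
  then have "ln ?g \<le> ln ?Z + real (card R) * \<tau> * ln (1 / c)"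
    using \<open>?g > 0\<close> by (simp only: mult_le_cancel_left_pos)
  also have "ln ?Z = real (card U) * ln 2 + real (card R) * ln (1 + c)"
    using c by (simp add: ln_mult ln_realpow)
  finally show ?thesis by (simp add: algebra_simps)
qed

text \<open>Let \<open>U i\<close> be the dense points of part \<open>i\<close>. Most members of
  \<open>W i\<close> live on \<open>U i\<close> and the leftover points \<open>R\<close>, which are
  sparse in every part. Summing the entropy bound over the parts forces \<open>R = {}\<close>, and
  integrality then fixes the sizes of the \<open>U i\<close>. \<open>\<theta>\<close> sets the
  sparsity that this needs; \<open>\<beta>\<close> is small enough both to trim the parts and to
  keep the \<open>U i\<close> disjoint.\<close>

lemma near_disjoint_families_are_cubes:
  fixes W :: "'i \<Rightarrow> 'a set set" and m \<kappa> \<beta> \<theta> :: real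
  assumes "finite V" "finite I" "card I = k" "k \<ge> 2" and W: "\<And>i. i \<in> I \<Longrightarrow> W i \<subseteq> Pow V"
    and "0 < m" and m: "(1 - \<kappa>) * real k * 2 powr (real (card V) / real k) \<le> m"
    and size: "\<And>i. i \<in> I \<Longrightarrow> (1 / real k - \<beta>) * m \<le> real (card (W i))"
    and cross: "\<And>i j. i \<in> I \<Longrightarrow> j \<in> I \<Longrightarrow> i \<noteq> j \<Longrightarrow>
      real (card {(A, B) \<in> W i \<times> W j. A \<inter> B \<noteq> {}}) \<le> \<beta> * m ^ 2"
    and \<kappa>: "0 < \<kappa>" "\<kappa> \<le> 1 / (64 * real k)"
    and \<theta>: "\<theta> = 1 / (128 * real k ^ 3)" and \<beta>: "\<beta> = \<kappa> * \<theta> / (2 * real k ^ 2)"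
  shows "\<exists>U. (\<Union>i\<in>I. U i) = V \<and> (\<forall>i\<in>I. \<forall>j\<in>I. i \<noteq> j \<longrightarrow> U i \<inter> U j = {}) \<and>
    (\<forall>i\<in>I. k * card (U i) = card V \<and> (1 - \<kappa>) * m / real k \<le> real (card (W i \<inter> Pow (U i))))"
proof -
  let ?k = "real k" and ?n = "card V"
  define U where "U i = {x \<in> V. \<theta> * m < real (card {A \<in> W i. x \<in> A})}" for i
  \<comment> \<open>Members of part \<open>i\<close> that meet many members of part
    \<open>j\<close>; the cross bound divided by \<open>\<theta> m\<close> limits their
    number.\<close>
  define bad where "bad i j = {A \<in> W i. \<theta> * m < real (card {B \<in> W j. A \<inter> B \<noteq> {}})}" for i j
  define G where "G i = W i - (\<Union>j\<in>I - {i}. bad i j)" for i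
  define R where "R = V - (\<Union>i\<in>I. U i)"
  have k: "?k \<ge> 2" using \<open>k \<ge> 2\<close> by simp
  have "\<theta> > 0" using k by (simp add: \<theta>)
  have "\<theta> \<le> 1"
  proof -
    have "1 \<le> ?k ^ 3" using k by (intro one_le_power) simp
    then have "1 \<le> 128 * ?k ^ 3" by linarith
    then show ?thesis unfolding \<theta> by (subst divide_le_eq_1_pos) (use k in simp_all)
  qed
  have "64 * ?k * \<kappa> \<le> 1" using \<kappa> k by (simp add: field_simps)
  moreover have "2 * \<kappa> \<le> ?k * \<kappa>" using k \<kappa> by (intro mult_right_mono) auto
  ultimately have "\<kappa> \<le> 1/128" by linarith
  have finW: "finite (W i)" if "i \<in> I" for i
    using W[OF that] \<open>finite V\<close> by (simp add: finite_subset)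
  have card_bad: "real (card (bad i j)) \<le> \<kappa> / (2 * ?k ^ 2) * m" if ij: "i \<in> I" "j \<in> I" "i \<noteq> j" for i j
  proof -
    have "\<theta> * m * real (card (bad i j)) = (\<Sum>A\<in>bad i j. \<theta> * m)" by simp
    also have "\<dots> \<le> (\<Sum>A\<in>bad i j. real (card {B \<in> W j. A \<inter> B \<noteq> {}}))"
      by (intro sum_mono) (auto simp: bad_def)
    also have "\<dots> \<le> (\<Sum>A\<in>W i. real (card {B \<in> W j. A \<inter> B \<noteq> {}}))"
      using finW[OF ij(1)] by (intro sum_mono2) (auto simp: bad_def)
    also have "\<dots> = real (card (SIGMA A:W i. {B \<in> W j. A \<inter> B \<noteq> {}}))"
      using finW[OF ij(1)] finW[OF ij(2)] by (subst card_SigmaI) auto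
    also have "(SIGMA A:W i. {B \<in> W j. A \<inter> B \<noteq> {}}) = {(A, B) \<in> W i \<times> W j. A \<inter> B \<noteq> {}}"
      by auto
    also have "real (card \<dots>) \<le> \<beta> * m ^ 2" by (rule cross[OF ij])
    also have "\<dots> = \<theta> * m * (\<kappa> / (2 * ?k ^ 2) * m)" by (simp add: \<beta> power2_eq_square)
    finally show ?thesis
      using \<open>\<theta> > 0\<close> \<open>0 < m\<close> by (simp only: mult_le_cancel_left_pos mult_pos_pos)
  qed
  \<comment> \<open>The loss \<open>\<kappa> m / k\<close> is split evenly between the bad members
    and the deficit \<open>\<beta> m\<close> in the size of \<open>W i\<close>.\<close>
  have card_G: "(1 - \<kappa>) * m / ?k \<le> real (card (G i))" if "i \<in> I" for i
  proof -
    have "real (card (\<Union>j\<in>I - {i}. bad i j)) \<le> real (\<Sum>j\<in>I - {i}. card (bad i j))"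
      using \<open>finite I\<close> by (intro of_nat_mono card_UN_le) simp
    also have "\<dots> = (\<Sum>j\<in>I - {i}. real (card (bad i j)))" by simp
    also have "\<dots> \<le> real (card (I - {i})) * (\<kappa> / (2 * ?k ^ 2) * m)"
      using card_bad that by (intro sum_bounded_above) auto
    also have "\<dots> \<le> ?k * (\<kappa> / (2 * ?k ^ 2) * m)"
      using \<open>card I = k\<close> \<open>finite I\<close> \<kappa> \<open>0 < m\<close> that by (intro mult_right_mono) auto
    also have "\<dots> = \<kappa> / (2 * ?k) * m" using k by (simp add: power2_eq_square)
    finally have *: "real (card (\<Union>j\<in>I - {i}. bad i j)) \<le> \<kappa> / (2 * ?k) * m" .
    have "card (W i) \<le> card (G i) + card (\<Union>j\<in>I - {i}. bad i j)"
    proof -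
      have "finite (\<Union>j\<in>I - {i}. bad i j)"
        using finW[OF that] \<open>finite I\<close> by (auto simp: bad_def)
      then have "card (W i) - card (\<Union>j\<in>I - {i}. bad i j) \<le> card (G i)"
        unfolding G_def by (rule diff_card_le_card_Diff)
      then show ?thesis by simp
    qed
    then have "real (card (W i)) \<le> real (card (G i)) + real (card (\<Union>j\<in>I - {i}. bad i j))"
      by (metis of_nat_add of_nat_mono)
    moreover have "\<beta> * m \<le> \<kappa> / (2 * ?k) * m"
    proof (intro mult_right_mono)
      have "\<theta> / ?k \<le> 1" using \<open>\<theta> \<le> 1\<close> k by (simp add: divide_le_eq)
      then have "\<kappa> / (2 * ?k) * (\<theta> / ?k) \<le> \<kappa> / (2 * ?k) * 1"
        using \<kappa> k by (intro mult_left_mono) auto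
      then show "\<beta> \<le> \<kappa> / (2 * ?k)" by (simp add: \<beta> power2_eq_square)
    qed (use \<open>0 < m\<close> in simp)
    ultimately have "(1 / ?k) * m - \<kappa> / (2 * ?k) * m - \<kappa> / (2 * ?k) * m \<le> real (card (G i))"
      using size[OF that] * by (simp add: left_diff_distrib)
    moreover have "(1 / ?k) * m - \<kappa> / (2 * ?k) * m - \<kappa> / (2 * ?k) * m = (1 - \<kappa>) * m / ?k"
      using k by (simp add: field_simps)
    ultimately show ?thesis by simp
  qed
  \<comment> \<open>A point of \<open>A\<close> in \<open>U j\<close> lies in more than
    \<open>\<theta> m\<close> members of \<open>W j\<close>, all of which meet \<open>A\<close>, so
    \<open>A\<close> would be bad.\<close>
  have G_avoid: "A \<inter> U j = {}" if ij: "i \<in> I" "j \<in> I" "i \<noteq> j" "A \<in> G i" for i j A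
  proof (rule ccontr)
    assume "A \<inter> U j \<noteq> {}"
    then obtain x where x: "x \<in> A" "x \<in> U j" by blast
    then have "\<theta> * m < real (card {B \<in> W j. x \<in> B})" by (simp add: U_def)
    also have "\<dots> \<le> real (card {B \<in> W j. A \<inter> B \<noteq> {}})"
      using finW[OF ij(2)] x by (intro of_nat_mono card_mono) auto
    finally have "A \<in> bad i j" using ij by (auto simp: bad_def G_def)
    with ij show False by (auto simp: G_def)
  qed
  \<comment> \<open>A common point would give more than \<open>\<theta>^2 m^2\<close> intersecting
    cross pairs, but \<open>\<beta> \<le> \<theta>^2\<close>.\<close>
  have U_disj: "U i \<inter> U j = {}" if ij: "i \<in> I" "j \<in> I" "i \<noteq> j" for i j
  proof (rule ccontr)
    assume "U i \<inter> U j \<noteq> {}"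
    then obtain x where x: "x \<in> U i" "x \<in> U j" by blast
    let ?W = "\<lambda>i. {A \<in> W i. x \<in> A}"
    have "(\<theta> * m) * (\<theta> * m) < real (card (?W i)) * real (card (?W j))"
      using x \<open>\<theta> > 0\<close> \<open>0 < m\<close> by (intro mult_strict_mono') (auto simp: U_def)
    also have "\<dots> = real (card (?W i \<times> ?W j))" by (simp add: card_cartesian_product)
    also have "\<dots> \<le> real (card {(A, B) \<in> W i \<times> W j. A \<inter> B \<noteq> {}})"
    proof (intro of_nat_mono card_mono)
      show "finite {(A, B) \<in> W i \<times> W j. A \<inter> B \<noteq> {}}"
        using finW[OF ij(1)] finW[OF ij(2)] by (auto intro: finite_subset[of _ "W i \<times> W j"])
    qed auto
    also have "\<dots> \<le> \<beta> * m ^ 2" by (rule cross[OF ij])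
    finally have "\<theta> ^ 2 * m ^ 2 < \<beta> * m ^ 2" by (simp add: power2_eq_square mult_ac)
    then have "\<theta> ^ 2 < \<beta>" using \<open>0 < m\<close> by simp
    moreover have "\<beta> = \<theta> * (64 * ?k * \<kappa>) * \<theta>"
      using k by (simp add: \<beta> \<theta> power2_eq_square power3_eq_cube)
    moreover have "\<theta> * (64 * ?k * \<kappa>) * \<theta> \<le> \<theta> * 1 * \<theta>"
      using \<open>64 * ?k * \<kappa> \<le> 1\<close> \<open>\<theta> > 0\<close> by (intro mult_right_mono mult_left_mono) auto
    ultimately show False by (simp add: power2_eq_square)
  qed
  have finU: "finite (U i)" for i using \<open>finite V\<close> by (simp add: U_def)
  have "finite R" using \<open>finite V\<close> by (simp add: R_def)
  have G_sub: "G i \<subseteq> Pow (U i \<union> R)" if "i \<in> I" for i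
  proof
    fix A assume "A \<in> G i"
    then have "A \<subseteq> V" using W[OF that] by (auto simp: G_def)
    with G_avoid[OF that _ _ \<open>A \<in> G i\<close>] show "A \<in> Pow (U i \<union> R)"
      by (auto simp: R_def)
  qed
  have card_V: "?n = (\<Sum>i\<in>I. card (U i)) + card R"
  proof -
    have "(\<Union>i\<in>I. U i) \<subseteq> V" by (auto simp: U_def)
    then have "?n = card (\<Union>i\<in>I. U i) + card R"
      unfolding R_def using \<open>finite V\<close>
      by (metis card_Diff_subset card_mono finite_subset le_add_diff_inverse)
    then show ?thesis
      using \<open>finite I\<close> finU U_disj by (subst (asm) card_UN_disjoint) auto
  qed
  have ln2: "1/2 \<le> ln (2::real)" using ln_le_minus_one[of "1/2"] by (simp add: ln_div)
  \<comment> \<open>\<open>G i\<close> has at least \<open>(1 - \<kappa>)^2 2^(n/k)\<close> members,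
    one factor coming from the size of \<open>m\<close> and one from the trimming; the logarithm
    loses at most \<open>4 \<kappa> \<le> 1 / (16k)\<close>.\<close>
  have entropy: "real ?n / ?k * ln 2 - 1 / (16 * ?k) \<le> real (card (U i)) * ln 2 + real (card R) / (4 * ?k)"
    if "i \<in> I" for i
  proof -
    define g where "g = real (card (G i))"
    have "(1 - \<kappa>) * ((1 - \<kappa>) * ?k * 2 powr (real ?n / ?k)) / ?k \<le> (1 - \<kappa>) * m / ?k"
      using m \<open>\<kappa> \<le> 1/128\<close> k by (intro divide_right_mono mult_left_mono) auto
    then have "(1 - \<kappa>) * (1 - \<kappa>) * 2 powr (real ?n / ?k) \<le> g"
      using card_G[OF that] k by (simp add: g_def)
    moreover have pos: "0 < (1 - \<kappa>) * (1 - \<kappa>) * 2 powr (real ?n / ?k)"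
      using \<open>\<kappa> \<le> 1/128\<close> by (intro mult_pos_pos) auto
    ultimately have "0 < g" "ln ((1 - \<kappa>) * (1 - \<kappa>) * 2 powr (real ?n / ?k)) \<le> ln g"
      by (auto simp: ln_le_cancel_iff simp del: powr_gt_zero)
    moreover have "ln ((1 - \<kappa>) * (1 - \<kappa>) * 2 powr (real ?n / ?k)) = 2 * ln (1 - \<kappa>) + real ?n / ?k * ln 2"
      using \<open>\<kappa> \<le> 1/128\<close> by (simp add: ln_mult ln_powr)
    moreover have "- 2 * \<kappa> \<le> ln (1 - \<kappa>)"
    proof -
      have "- \<kappa> - 2 * \<kappa>\<^sup>2 \<le> ln (1 - \<kappa>)"
        using \<kappa> \<open>\<kappa> \<le> 1/128\<close> by (intro ln_one_minus_pos_lower_bound) auto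
      moreover have "2 * \<kappa>\<^sup>2 \<le> \<kappa>"
        using \<kappa> \<open>\<kappa> \<le> 1/128\<close> by (simp add: power2_eq_square)
      ultimately show ?thesis by simp
    qed
    moreover have "4 * \<kappa> \<le> 1 / (16 * ?k)" using \<kappa> k by (simp add: field_simps)
    ultimately have "0 < g" and lower: "real ?n / ?k * ln 2 - 1 / (16 * ?k) \<le> ln g" by linarith+
    have sparse: "real (card {A \<in> G i. x \<in> A}) \<le> 1 / (64 * ?k ^ 2) * g" if "x \<in> R" for x
    proof -
      have "real (card {A \<in> G i. x \<in> A}) \<le> real (card {A \<in> W i. x \<in> A})"
        using finW[OF \<open>i \<in> I\<close>] by (intro of_nat_mono card_mono) (auto simp: G_def)
      also have "\<dots> \<le> \<theta> * m"
        using \<open>x \<in> R\<close> \<open>i \<in> I\<close> by (auto simp: R_def U_def)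
      also have "\<dots> = 1 / (64 * ?k ^ 2) * ((1/2) * m / ?k)"
        by (simp add: \<theta> power2_eq_square power3_eq_cube)
      also have "\<dots> \<le> 1 / (64 * ?k ^ 2) * ((1 - \<kappa>) * m / ?k)"
        using \<open>0 < m\<close> \<open>\<kappa> \<le> 1/128\<close> k
        by (intro mult_left_mono divide_right_mono mult_right_mono) auto
      also have "\<dots> \<le> 1 / (64 * ?k ^ 2) * g"
        unfolding g_def using card_G[OF \<open>i \<in> I\<close>] by (intro mult_left_mono) auto
      finally show ?thesis .
    qed
    have "ln g \<le> real (card (U i)) * ln 2
        + real (card R) * (ln (1 + 1 / (8 * ?k)) + 1 / (64 * ?k ^ 2) * ln (1 / (1 / (8 * ?k))))"
      unfolding g_def
    proof (rule ln_card_le_sparse_part)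
      show "G i \<noteq> {}" using \<open>0 < g\<close> by (auto simp: g_def)
    qed (use \<open>finite R\<close> finU G_sub[OF that] sparse k that in \<open>auto simp: R_def g_def\<close>)
    also have "\<dots> \<le> real (card (U i)) * ln 2 + real (card R) * (1 / (4 * ?k))"
    \<comment> \<open>With \<open>c = 1 / (8k)\<close> and \<open>\<tau> = 1 / (64k^2)\<close>, both
      summands are at most \<open>1 / (8k)\<close>.\<close>
    proof (intro add_left_mono mult_left_mono)
      have "ln (1 + 1 / (8 * ?k)) \<le> 1 / (8 * ?k)"
        using k by (intro ln_add_one_self_le_self) auto
      moreover have "1 / (64 * ?k ^ 2) * ln (1 / (1 / (8 * ?k))) \<le> 1 / (64 * ?k ^ 2) * (8 * ?k)"
        using k ln_le_minus_one[of "8 * ?k"] by (intro mult_left_mono) auto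
      moreover have "1 / (64 * ?k ^ 2) * (8 * ?k) = 1 / (8 * ?k)"
        using k by (simp add: power2_eq_square)
      moreover have "1 / (8 * ?k) + 1 / (8 * ?k) = 1 / (4 * ?k)" by simp
      ultimately show "ln (1 + 1 / (8 * ?k)) + 1 / (64 * ?k ^ 2) * ln (1 / (1 / (8 * ?k))) \<le> 1 / (4 * ?k)"
        by linarith
    qed simp
    finally show ?thesis using lower by simp
  qed
  \<comment> \<open>The \<open>U i\<close> together have \<open>n - card R\<close> points, so the
    sum gives \<open>card R (ln 2 - 1/4) \<le> 1/16\<close>; as \<open>ln 2 \<ge> 1/2\<close>, this
    leaves no room for even one point.\<close>
  have "(\<Sum>i\<in>I. real ?n / ?k * ln 2 - 1 / (16 * ?k)) \<le> (\<Sum>i\<in>I. real (card (U i)) * ln 2 + real (card R) / (4 * ?k))"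
    by (intro sum_mono entropy)
  then have "real ?n * ln 2 - 1/16 \<le> (\<Sum>i\<in>I. real (card (U i))) * ln 2 + real (card R) / 4"
    using \<open>card I = k\<close> k by (simp add: sum.distrib sum_distrib_right right_diff_distrib)
  moreover have "real ?n = (\<Sum>i\<in>I. real (card (U i))) + real (card R)"
    using card_V by simp
  ultimately have "real (card R) * ln 2 \<le> 1/16 + real (card R) / 4"
    by (simp add: algebra_simps)
  moreover have "real (card R) * (1/2) \<le> real (card R) * ln 2"
    using ln2 by (intro mult_left_mono) auto
  ultimately have "real (card R) < 1" by simp
  then have "card R = 0" by simp
  then have "R = {}" using \<open>finite R\<close> by simp
  \<comment> \<open>Integrality: falling short by one would cost \<open>ln 2\<close>, more than the
    slack \<open>1/16\<close>.\<close>
  have U_ge: "?n \<le> k * card (U i)" if "i \<in> I" for i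
  proof (rule ccontr)
    assume "\<not> ?thesis"
    then have "k * card (U i) + 1 \<le> ?n" by simp
    then have "real (k * card (U i) + 1) \<le> real ?n" by (rule of_nat_mono)
    then have "(real (k * card (U i)) + 1) * ln 2 \<le> real ?n * ln 2"
      using ln2 by (intro mult_right_mono) auto
    moreover have "real ?n * ln 2 - 1/16 \<le> real (k * card (U i)) * ln 2"
      using mult_left_mono[OF entropy[OF that], of ?k] k \<open>card R = 0\<close>
      by (simp add: algebra_simps)
    ultimately show False using ln2 by (simp add: algebra_simps)
  qed
  \<comment> \<open>The \<open>U i\<close> partition \<open>V\<close>, so the termwise inequalities
    have equal sums and are equalities.\<close>
  have "(\<Sum>i\<in>I. k * card (U i)) = (\<Sum>i\<in>I. ?n)"
    using card_V \<open>card R = 0\<close> \<open>card I = k\<close> by (simp add: sum_distrib_left[symmetric])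
  then have U_eq: "k * card (U i) = ?n" if "i \<in> I" for i
    using sum_mono_inv[of "\<lambda>_. ?n" I "\<lambda>i. k * card (U i)" i] U_ge that \<open>finite I\<close> by simp
  show ?thesis
  proof (intro exI[of _ U] conjI ballI impI)
    show "(\<Union>i\<in>I. U i) = V" using \<open>R = {}\<close> by (auto simp: R_def U_def)
    fix i assume "i \<in> I"
    have "G i \<subseteq> W i \<inter> Pow (U i)" using G_sub[OF \<open>i \<in> I\<close>] \<open>R = {}\<close> by (auto simp: G_def)
    then have "card (G i) \<le> card (W i \<inter> Pow (U i))"
      using finW[OF \<open>i \<in> I\<close>] by (intro card_mono) auto
    with card_G[OF \<open>i \<in> I\<close>] show "(1 - \<kappa>) * m / ?k \<le> real (card (W i \<inter> Pow (U i)))" by linarith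
  qed (use U_eq U_disj in auto)
qed

section \<open>The disjointness graph\<close>

text \<open>Distinctness removes the loop at the empty set, the only set disjoint from
  itself.\<close>

abbreviation disj_distinct :: "'a set \<Rightarrow> 'a set \<Rightarrow> bool" where
  "disj_distinct A B \<equiv> A \<noteq> B \<and> A \<inter> B = {}"

lemma finite_simple_graph_disj_distinct: "finite F \<Longrightarrow> finite_simple_graph F disj_distinct"
  unfolding finite_simple_graph_def by blast

text \<open>Listing each clique in one order gives as many tuples of \<open>k + 1\<close> disjoint
  sets. Were they dense, \<open>dense_disjoint_lists\<close> with \<open>X = V\<close> would yield
  \<open>(k + 1) * card V < (k + 1) * card V\<close>.\<close>

lemma few_disjoint_cliques:
  fixes k :: nat and \<gamma> :: real
  assumes "k \<ge> 1" and "\<gamma> > 0"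
  shows "\<exists>N. \<forall>(V :: 'a set) F. card V \<ge> N \<longrightarrow> finite V \<longrightarrow> F \<subseteq> Pow V \<longrightarrow>
    2 powr (real (card V) / real k) \<le> real (card F) \<longrightarrow>
    real (card (finite_simple_graph.cliques F disj_distinct (Suc k))) \<le> \<gamma> * real (card F) ^ Suc k"
proof -
  obtain N where N: "\<And>(V :: 'a set) F X T. card V \<ge> N \<Longrightarrow> finite V \<Longrightarrow> F \<subseteq> Pow V \<Longrightarrow>
    2 powr (real (card V) / real k) \<le> real (card F) \<Longrightarrow> X \<subseteq> V \<Longrightarrow>
    T \<subseteq> {xs \<in> lists_over (F \<inter> Pow X) (Suc k). sorted_wrt (\<lambda>A B. A \<inter> B = {}) xs} \<Longrightarrow>
    \<gamma> * real (card F) ^ Suc k \<le> real (card T) \<Longrightarrow> Suc k = 0 \<or> Suc k * card V < (k + 1) * card X"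
    using dense_disjoint_lists[OF assms, of "Suc k"] by blast
  show ?thesis
  proof (intro exI[of _ N] allI impI, rule ccontr)
    fix V :: "'a set" and F
    assume V: "N \<le> card V" "finite V" "F \<subseteq> Pow V" "2 powr (real (card V) / real k) \<le> real (card F)"
    interpret finite_simple_graph F disj_distinct
      using V by (intro finite_simple_graph_disj_distinct) (simp add: finite_subset)
    assume "\<not> real (card (cliques (Suc k))) \<le> \<gamma> * real (card F) ^ Suc k"
    then have many: "\<gamma> * real (card F) ^ Suc k \<le> real (card (cliques (Suc k)))" by simp
    define l where "l K = (SOME xs. set xs = K \<and> distinct xs)" for K :: "'a set set"
    have "set (l K) = K \<and> distinct (l K)" if "K \<in> cliques (Suc k)" for K
      unfolding l_def by (rule someI_ex[OF finite_distinct_list[OF finite_clique[OF that]]])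
    then have l: "set (l K) = K" "distinct (l K)" if "K \<in> cliques (Suc k)" for K
      using that by simp_all
    have "inj_on l (cliques (Suc k))"
      by (rule inj_on_inverseI[of _ set]) (rule l(1))
    then have card_l: "card (l ` cliques (Suc k)) = card (cliques (Suc k))"
      by (rule card_image)
    have "l ` cliques (Suc k) \<subseteq> {xs \<in> lists_over (F \<inter> Pow V) (Suc k). sorted_wrt (\<lambda>A B. A \<inter> B = {}) xs}"
    proof (intro image_subsetI CollectI conjI)
      fix K assume K: "K \<in> cliques (Suc k)"
      then have K': "K \<subseteq> F" "card K = Suc k" "\<And>A B. A \<in> K \<Longrightarrow> B \<in> K \<Longrightarrow> A \<noteq> B \<Longrightarrow> A \<inter> B = {}"
        by (auto simp: cliques_def)
      have "length (l K) = Suc k" using distinct_card[OF l(2)[OF K]] l(1)[OF K] K' by simp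
      then show "l K \<in> lists_over (F \<inter> Pow V) (Suc k)"
        using l(1)[OF K] K' V(3) by (auto simp: lists_over_def)
      have "sorted_wrt (\<lambda>A B. A \<inter> B = {}) xs" if "set xs \<subseteq> K" "distinct xs" for xs
        using that K'(3) by (induction xs) auto
      then show "sorted_wrt (\<lambda>A B. A \<inter> B = {}) (l K)" using l[OF K] by simp
    qed
    from N[OF V subset_refl this] many card_l show False by simp
  qed
qed

text \<open>The \<open>2\<close> pays for the pair \<open>A = B = {}\<close>, which
  \<open>dp\<close> counts but which is not an edge; every other pair is an edge and gives two
  arcs.\<close>

lemma dp_le_arcs:
  assumes "finite F"
  shows "2 * dp F \<le> card (finite_simple_graph.arcs disj_distinct F) + 2"
proof -
  interpret finite_simple_graph F disj_distinct
    using assms by (rule finite_simple_graph_disj_distinct)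
  have "{{A, B} | A B. A \<in> F \<and> B \<in> F \<and> A \<inter> B = {}} \<subseteq> insert {{}} (cliques 2)"
  proof
    fix d assume "d \<in> {{A, B} | A B. A \<in> F \<and> B \<in> F \<and> A \<inter> B = {}}"
    then obtain A B where AB: "d = {A, B}" "A \<in> F" "B \<in> F" "A \<inter> B = {}" by blast
    show "d \<in> insert {{}} (cliques 2)"
    proof (cases "A = B")
      case True
      with AB show ?thesis by simp
    next
      case False
      with AB have "d \<in> cliques 2" by (auto simp: cliques_def)
      then show ?thesis by simp
    qed
  qed
  then have "dp F \<le> card (insert {{}} (cliques 2))"
    unfolding dp_def by (intro card_mono) auto
  also have "\<dots> \<le> Suc (card (cliques 2))" by (rule card_insert_le_m1) simp_all
  finally show ?thesis using card_arcs_V by simp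
qed

section \<open>From the density hypothesis to a balanced series of cubes\<close>

theorem theorem1p5:
  fixes \<epsilon> :: real and k :: nat
  assumes "\<epsilon> > 0" and "k \<ge> 2"
  shows "\<exists>\<eta>::real. \<eta> > 0 \<and>
    (\<exists>N::nat. \<forall>n\<ge>N. \<forall>F::nat set set.
       F \<subseteq> Pow {1..n} \<longrightarrow>
       real (card F) \<ge> (1 - \<eta>) * real k * 2 powr (real n / real k) \<longrightarrow>
       real (dp F) \<ge> (1 - 1 / real k - \<eta>) * real (card F) ^ 2 / 2 \<longrightarrow>
       (k dvd n \<and>
        (\<exists>C. balanced_series k n C \<and> real (card (F - C)) \<le> \<epsilon> * real (card F))))"
proof -
  let ?k = "real k"
  have k: "?k \<ge> 2" using \<open>k \<ge> 2\<close> by simp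
  \<comment> \<open>The constants are chosen backwards: \<open>\<kappa>\<close> is the proportion
    finally lost, \<open>\<theta>\<close> and \<open>\<beta>\<close> suit the cube lemma,
    \<open>6 * \<delta> = \<beta> ^ 2\<close> suits the bounds on the parts, and
    \<open>\<eta>\<close> and \<open>\<gamma>\<close> each supply half of the error
    \<open>\<delta>\<close> in the partition lemma.\<close>
  define \<kappa> where "\<kappa> = min \<epsilon> (1 / (64 * ?k))"
  define \<theta> where "\<theta> = 1 / (128 * ?k ^ 3)"
  define \<beta> where "\<beta> = \<kappa> * \<theta> / (2 * ?k ^ 2)"
  define \<delta> where "\<delta> = \<beta> ^ 2 / 6"
  define \<eta> where "\<eta> = \<delta> / (2 * ?k ^ 2)"
  define \<gamma> where "\<gamma> = \<delta> / (4 * ?k * real (k + 1) * (2 * ?k ^ 2) ^ k)"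
  have \<kappa>: "0 < \<kappa>" "\<kappa> \<le> 1 / (64 * ?k)" "\<kappa> \<le> \<epsilon>" using \<open>\<epsilon> > 0\<close> k by (auto simp: \<kappa>_def)
  have "1 / (64 * ?k) \<le> 1" using k by (simp add: divide_le_eq)
  with \<kappa> have "\<kappa> \<le> 1" by linarith
  have pow_ge: "1 \<le> ?k ^ j" for j using k by (intro one_le_power) simp
  have "0 < \<theta>" using k by (simp add: \<theta>_def)
  have "\<theta> \<le> 1" unfolding \<theta>_def using pow_ge[of 3] k by (subst divide_le_eq_1_pos) (simp, linarith)
  have "0 < \<beta>" using \<kappa> \<open>0 < \<theta>\<close> k by (simp add: \<beta>_def)
  have "\<beta> \<le> \<kappa>"
  proof -
    have "\<theta> / (2 * ?k ^ 2) \<le> 1"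
      using pow_ge[of 2] \<open>\<theta> \<le> 1\<close> k by (subst divide_le_eq_1_pos) (simp, linarith)
    then have "\<kappa> * (\<theta> / (2 * ?k ^ 2)) \<le> \<kappa> * 1" using \<kappa> by (intro mult_left_mono) auto
    then show ?thesis by (simp add: \<beta>_def)
  qed
  with \<open>\<kappa> \<le> 1\<close> have "\<beta> \<le> 1" by linarith
  have "0 < \<delta>" using \<open>0 < \<beta>\<close> by (simp add: \<delta>_def)
  have "\<beta> ^ 2 \<le> \<beta>" using \<open>0 < \<beta>\<close> \<open>\<beta> \<le> 1\<close> by (simp add: power2_eq_square mult_left_le)
  then have "\<delta> \<le> \<beta>" using \<open>0 < \<beta>\<close> by (simp add: \<delta>_def)
  have "0 < \<eta>" using \<open>0 < \<delta>\<close> k by (simp add: \<eta>_def)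
  have "\<eta> \<le> \<delta>"
  proof -
    have "\<delta> * 1 \<le> \<delta> * (2 * ?k ^ 2)"
      using pow_ge[of 2] \<open>0 < \<delta>\<close> by (intro mult_left_mono) linarith+
    then show ?thesis using k by (simp add: \<eta>_def divide_le_eq)
  qed
  have "\<delta> \<le> 1" "\<eta> \<le> \<kappa>" using \<open>\<delta> \<le> \<beta>\<close> \<open>\<beta> \<le> 1\<close> \<open>\<beta> \<le> \<kappa>\<close> \<open>\<eta> \<le> \<delta>\<close> by linarith+
  have "\<eta> \<le> 1 / (2 * ?k ^ 2)" using \<open>\<delta> \<le> 1\<close> by (simp add: \<eta>_def divide_right_mono)
  have "0 < \<gamma>" using \<open>0 < \<delta>\<close> k by (simp add: \<gamma>_def)
  have const: "?k ^ 2 * \<eta> + 2 * ?k * real (k + 1) * \<gamma> * (2 * ?k ^ 2) ^ k = \<delta>"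
  proof -
    define z where "z = ?k * real (k + 1) * (2 * ?k ^ 2) ^ k"
    have "z > 0" using k by (simp add: z_def)
    have "\<gamma> = \<delta> / (4 * z)" by (simp add: \<gamma>_def z_def mult.assoc)
    then have "2 * z * \<gamma> = \<delta> / 2" using \<open>z > 0\<close> by simp
    moreover have "?k ^ 2 * \<eta> = \<delta> / 2" using k by (simp add: \<eta>_def)
    moreover have "2 * ?k * real (k + 1) * \<gamma> * (2 * ?k ^ 2) ^ k = 2 * z * \<gamma>"
      by (simp only: z_def mult_ac)
    ultimately show ?thesis by linarith
  qed
  have "1 \<le> k" using \<open>k \<ge> 2\<close> by simp
  obtain N where N: "\<And>(V :: nat set) F. card V \<ge> N \<Longrightarrow> finite V \<Longrightarrow> F \<subseteq> Pow V \<Longrightarrow>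
    2 powr (real (card V) / ?k) \<le> real (card F) \<Longrightarrow>
    real (card (finite_simple_graph.cliques F disj_distinct (Suc k))) \<le> \<gamma> * real (card F) ^ Suc k"
    using few_disjoint_cliques[OF \<open>1 \<le> k\<close> \<open>0 < \<gamma>\<close>] by blast
  obtain M :: nat where M: "8 * ?k / \<eta> \<le> real M" using real_arch_simple by blast
  show ?thesis
  \<comment> \<open>Halving \<open>\<eta>\<close> leaves \<open>\<eta> m^2 / 2\<close> to absorb the
    additive \<open>2\<close> from the pair of empty sets; \<open>n \<ge> M\<close> makes this at
    least \<open>2\<close>.\<close>
  proof (intro exI[of _ "\<eta> / 2"] conjI exI[of _ "max N M"] allI impI)
    show "0 < \<eta> / 2" using \<open>0 < \<eta>\<close> by simp
  next
    fix n and F :: "nat set set"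
    assume n: "max N M \<le> n" and F: "F \<subseteq> Pow {1..n}"
      and size: "(1 - \<eta> / 2) * ?k * 2 powr (real n / ?k) \<le> real (card F)"
      and dp: "(1 - 1 / ?k - \<eta> / 2) * real (card F) ^ 2 / 2 \<le> real (dp F)"
    let ?m = "real (card F)"
    have "finite F" using F by (simp add: finite_subset)
    interpret finite_simple_graph F disj_distinct
      using \<open>finite F\<close> by (rule finite_simple_graph_disj_distinct)
    have "1 \<le> (1 - \<eta> / 2) * ?k"
    proof -
      have "(1/2) * 2 \<le> (1 - \<eta> / 2) * ?k"
        using \<open>\<eta> \<le> \<delta>\<close> \<open>\<delta> \<le> 1\<close> k by (intro mult_mono) auto
      then show ?thesis by simp
    qed
    then have "1 * 2 powr (real n / ?k) \<le> (1 - \<eta> / 2) * ?k * 2 powr (real n / ?k)"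
      by (intro mult_right_mono) auto
    with size have large: "2 powr (real n / ?k) \<le> ?m" by linarith
    moreover have "0 < 2 powr (real n / ?k)" by simp
    ultimately have "0 < ?m" by linarith
    then have "F \<noteq> {}" by auto
    have m_large: "(1 - \<kappa>) * ?k * 2 powr (real n / ?k) \<le> ?m"
    proof -
      have "(1 - \<kappa>) * ?k * 2 powr (real n / ?k) \<le> (1 - \<eta> / 2) * ?k * 2 powr (real n / ?k)"
        using \<open>\<eta> \<le> \<kappa>\<close> \<open>0 < \<eta>\<close> by (intro mult_right_mono) auto
      with size show ?thesis by linarith
    qed
    have "4 \<le> \<eta> * ?m ^ 2"
    proof -
      have "1 / 2 \<le> ln (2::real)" using ln_le_minus_one[of "1/2"] by (simp add: ln_div)
      then have "real n / ?k * (1/2) \<le> real n / ?k * ln 2" by (intro mult_left_mono) auto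
      also have "\<dots> \<le> exp (real n / ?k * ln 2)"
        using exp_ge_add_one_self[of "real n / ?k * ln 2"] by linarith
      also have "\<dots> = 2 powr (real n / ?k)" by (simp add: powr_def)
      also note large
      finally have "real n \<le> 2 * ?k * ?m" using k by (simp add: field_simps)
      moreover have "8 * ?k / \<eta> \<le> real n" using M n by simp
      ultimately have "8 * ?k / \<eta> \<le> 2 * ?k * ?m" by linarith
      then have "4 \<le> \<eta> * ?m" using k \<open>0 < \<eta>\<close> by (simp add: field_simps)
      also have "\<dots> \<le> \<eta> * ?m ^ 2"
      proof (intro mult_left_mono)
        have "1 \<le> ?m" using \<open>0 < ?m\<close> by simp
        then show "?m \<le> ?m ^ 2" using mult_left_mono[of 1 ?m ?m] by (simp add: power2_eq_square)
      qed (use \<open>0 < \<eta>\<close> in simp)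
      finally show ?thesis .
    qed
    have dense: "(1 - 1 / ?k - \<eta>) * ?m ^ 2 \<le> real (card (arcs F))"
    proof -
      have "real (2 * dp F) \<le> real (card (arcs F) + 2)"
        using dp_le_arcs[OF \<open>finite F\<close>] by (rule of_nat_mono)
      moreover have "(1 - 1 / ?k - \<eta> / 2) * ?m ^ 2 = (1 - 1 / ?k - \<eta>) * ?m ^ 2 + \<eta> * ?m ^ 2 / 2"
        by (simp add: algebra_simps)
      ultimately show ?thesis using dp \<open>4 \<le> \<eta> * ?m ^ 2\<close> by simp
    qed
    have few: "real (card (cliques (Suc k))) \<le> \<gamma> * ?m ^ Suc k"
      using N[of "{1..n}" F] n F large by simp
    obtain K where K: "K \<in> cliques k"
      and near: "?m * (?m - (\<Sum>A\<in>K. real (card (private_nbrs K A))))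
        + (\<Sum>A\<in>K. real (card (arcs (private_nbrs K A)))) \<le> \<delta> * ?m ^ 2"
      using near_Turan_partition[OF \<open>k \<ge> 2\<close> _ \<open>\<eta> \<le> 1 / (2 * ?k ^ 2)\<close> \<open>F \<noteq> {}\<close> dense few] \<open>0 < \<eta>\<close>
      unfolding const by auto
    define W where "W = private_nbrs K"
    have "finite K" using K by (rule finite_clique)
    have "card K = k" using K by (simp add: cliques_def)
    note near = near[folded W_def]
    have W_sub: "W A \<subseteq> F" for A unfolding W_def by (rule private_nbrs_subset)
    have W_disj: "W A \<inter> W B = {}" if "A \<in> K" "B \<in> K" "A \<noteq> B" for A B
      unfolding W_def using that by (rule disjoint_private_nbrs)
    have "(\<Sum>A\<in>K. real (card (W A))) \<le> ?m"
    proof -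
      have "(\<Sum>A\<in>K. card (W A)) \<le> card F"
        using sum_card_private_nbrs_le[OF \<open>finite K\<close>] by (simp add: W_def)
      then have "real (\<Sum>A\<in>K. card (W A)) \<le> ?m" by (rule of_nat_mono)
      then show ?thesis by simp
    qed
    \<comment> \<open>Both summands in \<open>near\<close> are nonnegative, so each alone is at most
      \<open>\<delta> m^2\<close>.\<close>
    then have "0 \<le> ?m * (?m - (\<Sum>A\<in>K. real (card (W A))))" by simp
    with near have inner: "(\<Sum>A\<in>K. real (card (arcs (W A)))) \<le> \<delta> * ?m ^ 2"
      by linarith
    have "0 \<le> (\<Sum>A\<in>K. real (card (arcs (W A))))" by (intro sum_nonneg) simp
    with near have "?m * (?m - (\<Sum>A\<in>K. real (card (W A)))) \<le> \<delta> * ?m ^ 2"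
      by linarith
    also have "\<dots> = ?m * (\<delta> * ?m)"
      by (simp only: power2_eq_square mult_ac)
    finally have "?m - (\<Sum>A\<in>K. real (card (W A))) \<le> \<delta> * ?m"
      using \<open>0 < ?m\<close> by (simp only: mult_le_cancel_left_pos)
    then have cover: "(1 - \<delta>) * ?m \<le> (\<Sum>A\<in>K. real (card (W A)))"
      by (simp add: left_diff_distrib)
    have parts: "A \<in> K \<Longrightarrow> (1 / ?k - \<beta>) * ?m \<le> real (card (W A))"
      "A \<in> K \<Longrightarrow> B \<in> K \<Longrightarrow> A \<noteq> B \<Longrightarrow>
        real (card {(X, Y) \<in> W A \<times> W B. \<not> disj_distinct X Y}) \<le> \<beta> * ?m ^ 2" for A B
      using near_Turan_parts[OF \<open>finite K\<close> \<open>card K = k\<close> _ W_sub W_disj dense cover inner \<open>\<eta> \<le> \<delta>\<close>, of \<beta>]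
        \<open>k \<ge> 2\<close> \<open>0 < \<delta>\<close> \<open>\<delta> \<le> 1\<close> \<open>0 < \<beta>\<close> \<open>\<beta> \<le> 1\<close> by (auto simp: \<delta>_def)
    \<comment> \<open>Members of different parts are distinct, so non-adjacency here means
      intersecting.\<close>
    have cross: "real (card {(X, Y) \<in> W A \<times> W B. X \<inter> Y \<noteq> {}}) \<le> \<beta> * ?m ^ 2"
      if "A \<in> K" "B \<in> K" "A \<noteq> B" for A B
    proof -
      have "{(X, Y) \<in> W A \<times> W B. X \<inter> Y \<noteq> {}} = {(X, Y) \<in> W A \<times> W B. \<not> disj_distinct X Y}"
        using W_disj[OF that] by blast
      then show ?thesis using parts(2)[OF that] by simp
    qed
    have W_Pow: "W A \<subseteq> Pow {1..n}" if "A \<in> K" for A using W_sub F by (rule subset_trans)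
    have m_large': "(1 - \<kappa>) * ?k * 2 powr (real (card {1..n}) / ?k) \<le> ?m" using m_large by simp
    have "\<exists>U. (\<Union>A\<in>K. U A) = {1..n} \<and> (\<forall>A\<in>K. \<forall>B\<in>K. A \<noteq> B \<longrightarrow> U A \<inter> U B = {}) \<and>
      (\<forall>A\<in>K. k * card (U A) = card {1..n} \<and> (1 - \<kappa>) * ?m / ?k \<le> real (card (W A \<inter> Pow (U A))))"
      by (rule near_disjoint_families_are_cubes[where \<beta> = \<beta> and \<theta> = \<theta>])
        (fact finite_atLeastAtMost \<open>finite K\<close> \<open>card K = k\<close> \<open>k \<ge> 2\<close> W_Pow \<open>0 < ?m\<close> m_large'
          parts(1) cross \<kappa>(1) \<kappa>(2) \<theta>_def \<beta>_def)+
    then obtain U where U: "(\<Union>A\<in>K. U A) = {1..n}" "\<forall>A\<in>K. \<forall>B\<in>K. A \<noteq> B \<longrightarrow> U A \<inter> U B = {}"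
      and U_all: "\<forall>A\<in>K. k * card (U A) = card {1..n} \<and>
        (1 - \<kappa>) * ?m / ?k \<le> real (card (W A \<inter> Pow (U A)))"
      by (elim exE conjE)
    have U_card: "k * card (U A) = n" if "A \<in> K" for A
      using bspec[OF U_all that] by simp
    have U_rich: "(1 - \<kappa>) * ?m / ?k \<le> real (card (W A \<inter> Pow (U A)))" if "A \<in> K" for A
      using bspec[OF U_all that] by blast
    have "K \<noteq> {}" using \<open>card K = k\<close> \<open>k \<ge> 2\<close> by auto
    then obtain A0 where "A0 \<in> K" by blast
    show "k dvd n" using U_card[OF \<open>A0 \<in> K\<close>] by (metis dvd_triv_left)
    then have card_U: "card (U A) = n div k" if "A \<in> K" for A
      using U_card[OF that] \<open>k \<ge> 2\<close> by (metis nonzero_mult_div_cancel_left not_numeral_le_zero)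
    \<comment> \<open>The cubes are indexed by the vertices of the clique \<open>K\<close>; a
      balanced series asks for indices below \<open>k\<close>.\<close>
    obtain f where f: "bij_betw f {..<k} K"
      using ex_bij_betw_nat_finite[OF \<open>finite K\<close>] \<open>card K = k\<close> by (auto simp: atLeast0LessThan)
    define C where "C = (\<Union>A\<in>K. Pow (U A))"
    have image: "f ` {..<k} = K" using f by (simp add: bij_betw_def)
    have "balanced_series k n C"
      unfolding balanced_series_def
    proof (intro exI[of _ "\<lambda>i. U (f i)"] conjI allI impI)
      have "(\<Union>i<k. U (f i)) = (\<Union>A\<in>f ` {..<k}. U A)" by simp
      then show "(\<Union>i<k. U (f i)) = {1..n}" using U(1) image by simp
      have "(\<Union>i<k. Pow (U (f i))) = (\<Union>A\<in>f ` {..<k}. Pow (U A))" by simp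
      then show "C = (\<Union>i<k. Pow (U (f i)))" using image by (simp add: C_def)
    next
      fix i j assume "i < k" "j < k" "i \<noteq> j"
      then have "f i \<noteq> f j" "f i \<in> K" "f j \<in> K"
        using f by (auto simp: bij_betw_def inj_on_def)
      then show "U (f i) \<inter> U (f j) = {}" using U(2) by blast
    next
      fix i assume "i < k"
      then have "f i \<in> K" using image by blast
      then show "n div k \<le> card (U (f i))" "card (U (f i)) \<le> (n + k - 1) div k"
        using card_U \<open>k \<ge> 2\<close> by (auto intro: div_le_mono)
    qed
    moreover have "real (card (F - C)) \<le> \<epsilon> * ?m"
    proof -
      have finW: "finite (W A \<inter> Pow (U A))" for A
        using W_sub[of A] \<open>finite F\<close> by (meson finite_Int finite_subset)
      \<comment> \<open>The families \<open>W A \<inter> Pow (U A)\<close> are disjoint subfamilies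
        of \<open>F \<inter> C\<close>, so their sizes add up.\<close>
      have "(1 - \<kappa>) * ?m = (\<Sum>A\<in>K. (1 - \<kappa>) * ?m / ?k)" using \<open>card K = k\<close> k by simp
      also have "\<dots> \<le> (\<Sum>A\<in>K. real (card (W A \<inter> Pow (U A))))" by (intro sum_mono U_rich)
      also have "\<dots> = real (card (\<Union>A\<in>K. W A \<inter> Pow (U A)))"
        using \<open>finite K\<close> finW W_disj by (subst card_UN_disjoint) auto
      also have "\<dots> \<le> real (card (F \<inter> C))"
        using \<open>finite F\<close> W_sub by (intro of_nat_mono card_mono) (auto simp: C_def)
      finally have "(1 - \<kappa>) * ?m \<le> real (card (F \<inter> C))" .
      moreover have "?m = real (card (F - C)) + real (card (F \<inter> C))"
        using card_Int_Diff[OF \<open>finite F\<close>, of C] by simp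
      ultimately have "real (card (F - C)) \<le> \<kappa> * ?m" by (simp add: algebra_simps)
      also have "\<dots> \<le> \<epsilon> * ?m" using \<open>\<kappa> \<le> \<epsilon>\<close> by (intro mult_right_mono) auto
      finally show ?thesis .
    qed
    ultimately show "\<exists>C. balanced_series k n C \<and> real (card (F - C)) \<le> \<epsilon> * ?m" by blast
  qed
qed

end
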